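(* For every complex number $q$ with $|q|<1$, \begin{align*} 1 &- 4 \sum_{r,s\ge 1}q^{2rs}(-1)^{r+s} - 2\sum_{s,t\ge 1}q^{4st}(-1)^{s+t}-2 \sum_{s,t\ge 1}q^{(2s-1)(2t-1)}(-1)^{s+t}\\ &-4\sum_{r,s,t\ge 1} q^{2rs+2rt+4st}(-1)^{r+s+t} -4 \sum_{r,s,t\ge 1}q^{r(2s-1)+r(2t-1)+(2s-1)(2t-1)}(-1)^{r+s+t}\\ &=\frac{(q;q)_{\infty}}{(-q;q)_{\infty}} \left( \frac{(q^2;q^2)_{\infty}}{(-q^2;q^2)_{\infty}}\right )^2 . \end{align*}
   Context: For $|q|<1$, $(x;q)_\infty=\prod_{k\ge 0}(1-xq^k)$. All summation indices $r,s,t$ range over positive integers. *)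

theory Defs
  imports "HOL-Analysis.Analysis"
begin

definition qpochhammer_inf :: "complex \<Rightarrow> complex \<Rightarrow> complex" where
  "qpochhammer_inf x q = (\<Prod>k. 1 - x * q ^ k)"

end

theory Submission
  imports Defs
begin

text \<open>Write \<open>n = (a + b) / 2\<close>, \<open>k = (a - b) / 2\<close> where \<open>a, b\<close> are \<open>2s, 2t\<close> or \<open>2s - 1, 2t - 1\<close>, and sum the
  geometric series over \<open>r\<close>. The left-hand side becomes a Hecke-type sum
  \<open>1 + 4 \<Sum> (-1)^m y_m - 2 \<Sum> (1 - 2 y_n) \<tau>_n\<close> with \<open>y_n = q^(2n) / (1 + q^(2n))\<close> and
  \<open>\<tau>_n = \<Sum>_{\<bar>k\<bar> < n} (-1)^k q^(n^2 - k^2)\<close>. Up to the factor \<open>-2 (-1)^n / \<theta>(q)\<close>, where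
  \<open>\<theta>(q) = \<Sum>_k q^(k^2)\<close>, the sequence \<open>\<tau>_n\<close> is the convolution of \<open>q^(k^2)\<close> with \<open>y\<close>, because both satisfy the
  same first-order recursion. Since \<open>1 - 2 y_n\<close> is a hyperbolic tangent, its addition theorem makes the
  terms with \<open>k \<noteq> 0\<close> telescope, and \<open>\<theta>(q)\<close> times the left-hand side is \<open>4 \<Sum>_n (-1)^n v_n^2\<close>,
  \<open>v_n = q^n / (1 + q^(2n))\<close>. The same telescoping shows \<open>\<Sum>_n (-1)^n v_n^2 = g^2\<close> for
  \<open>g = \<Sum>_k (-1)^k q^(k^2) v_k\<close>. A Landen-type argument gives \<open>2 g = \<theta>(q) \<theta>(-q) = \<theta>(-q^2)^2\<close>,
  so the left-hand side is \<open>\<theta>(-q) \<theta>(-q^2)^2\<close>, and Gauss's product for \<open>\<theta>(-q)\<close> concludes.\<close>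

section \<open>Gauss's product\<close>

text \<open>Recursions in an integer index need negative powers of \<open>q\<close>, so the argument
  runs under \<open>nome\<close> and \<open>q = 0\<close> is treated apart. The main obstacle is
  that \<open>y_n\<close> tends to 1 as \<open>n\<close> tends to minus infinity: alternating sums
  of \<open>y\<close> over all integers diverge and cannot be shifted or reflected termwise. Only
  differences of shifts, theta-weighted sums and sums over \<open>n \<ge> 1\<close> are formed, and
  the symmetry \<open>y_(-n) = 1 - y_n\<close> supplies the boundary constants that naive shifting
  would lose. The Landen-type argument needs no product formula for \<open>g\<close>. Since
  \<open>g\<close> is even in \<open>q\<close>, and summing a convolution in two ways gives
  \<open>\<theta>(-q) g = \<theta>(q) V(-q)\<close> with \<open>V = \<Sum>_j v_j\<close>, the ratio
  \<open>V / \<theta>^2\<close> agrees at \<open>q\<close> and \<open>-q\<close>. Even-odd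
  dissections of \<open>V\<close> and \<open>\<theta>^2\<close> carry the ratio to
  \<open>q^2\<close>; iterated squaring sends the nome to 0, where the ratio is 1/2. This is
  Jacobi's two squares theorem. Division by \<theta> is legitimate because Gauss's product shows
  that it has no zeros.\<close>

lemma one_minus_power_nonzero:
  fixes q :: complex
  assumes "norm q < 1" "n > 0"
  shows "1 - q ^ n \<noteq> 0" "1 + q ^ n \<noteq> 0"
proof -
  have "norm (q ^ n) < 1"
    using assms by (simp add: norm_power power_less_one_iff)
  then show "1 - q ^ n \<noteq> 0" "1 + q ^ n \<noteq> 0"
    by (metis norm_one less_irrefl right_minus_eq)
       (metis \<open>norm (q ^ n) < 1\<close> add_eq_0_iff norm_minus_cancel norm_one less_irrefl)
qed

text \<open>An absolutely convergent product without a zero factor is nonzero. The values c = 1 and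
  c = -1 give the numerator and the denominator of Gauss's quotient.\<close>

lemma qpochhammer_inf_diag:
  assumes "norm q < 1" "norm c = 1"
  shows "qpochhammer_inf (c * q) q \<noteq> 0"
    and "(\<lambda>n. \<Prod>k<n. 1 - c * q ^ Suc k) \<longlonglongrightarrow> qpochhammer_inf (c * q) q"
proof -
  have "summable (\<lambda>k. norm q * norm q ^ k)"
    using assms by (intro summable_mult summable_geometric) auto
  then have "summable (\<lambda>k. norm ((1 - c * q * q ^ k) - 1))"
    using assms by (simp add: norm_mult norm_power)
  then have conv: "convergent_prod (\<lambda>k. 1 - c * q * q ^ k)"
    using abs_convergent_prod_conv_summable abs_convergent_prod_imp_convergent_prod by blast
  have nz: "1 - c * q * q ^ k \<noteq> 0" for k
  proof
    assume "1 - c * q * q ^ k = 0"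
    then have "norm (c * q ^ Suc k) = 1" by (simp add: mult.assoc)
    moreover have "norm (c * q ^ Suc k) < 1"
      using assms by (simp add: norm_mult norm_power power_less_one_iff del: power_Suc)
    ultimately show False by simp
  qed
  show "qpochhammer_inf (c * q) q \<noteq> 0"
    unfolding qpochhammer_inf_def using prodinf_nonzero[OF conv nz] by simp
  have "(\<lambda>n. \<Prod>k<n. 1 - c * q * q ^ k) \<longlonglongrightarrow> qpochhammer_inf (c * q) q"
    unfolding qpochhammer_inf_def
    using convergent_prod_LIMSEQ[OF conv] LIMSEQ_lessThan_iff_atMost[of "\<lambda>A. \<Prod>k\<in>A. 1 - c * q * q ^ k"] by blast
  then show "(\<lambda>n. \<Prod>k<n. 1 - c * q ^ Suc k) \<longlonglongrightarrow> qpochhammer_inf (c * q) q"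
    by (simp add: mult.assoc)
qed

text \<open>In q-notation this is (-1)^s (-1;q)_s / (q;q)_s. Its factor at i = 0 contains 1 + q^0 =
  2, which \<open>gauss_prod\<close> omits; this is the 2 in front of the theta terms.\<close>

definition shanks_coeff :: "complex \<Rightarrow> nat \<Rightarrow> complex" where
  "shanks_coeff q s = (\<Prod>i<s. - ((1 + q ^ i) / (1 - q ^ Suc i)))"

definition gauss_prod :: "complex \<Rightarrow> nat \<Rightarrow> complex" where
  "gauss_prod q n = (\<Prod>i<n. (1 - q ^ Suc i) / (1 + q ^ Suc i))"

lemma shanks_coeff_Suc:
  assumes "norm q < 1"
  shows "shanks_coeff q (Suc s) * (1 - q ^ Suc s) = - shanks_coeff q s * (1 + q ^ s)"
  using one_minus_power_nonzero[OF assms, of "Suc s"] by (simp add: shanks_coeff_def)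

lemma shanks_coeff_gauss_prod:
  assumes "norm q < 1"
  shows "shanks_coeff q n * (1 + q ^ n) * gauss_prod q n = 2 * (-1) ^ n"
proof (induction n)
  case 0
  then show ?case by (simp add: shanks_coeff_def gauss_prod_def)
next
  case (Suc n)
  have nz: "1 - q ^ Suc n \<noteq> 0" "1 + q ^ Suc n \<noteq> 0"
    using one_minus_power_nonzero[OF assms, of "Suc n"] by auto
  have "shanks_coeff q (Suc n) * (1 + q ^ Suc n) * gauss_prod q (Suc n)
      = (shanks_coeff q (Suc n) * (1 - q ^ Suc n)) * gauss_prod q n"
    using nz by (simp add: gauss_prod_def)
  also have "\<dots> = - (shanks_coeff q n * (1 + q ^ n) * gauss_prod q n)"
    unfolding shanks_coeff_Suc[OF assms] by (simp add: algebra_simps)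
  finally show ?case using Suc.IH by simp
qed

text \<open>Each summand is the difference of two consecutive values of the right-hand side. The
  identity trades the exponent N s for (N + 1) s, exactly the change that the sum in
  \<open>shanks_identity\<close> undergoes from one n to the next.\<close>

lemma shanks_telescope:
  assumes "norm q < 1"
  shows "(\<Sum>s\<le>m. ((1 - q ^ N) * q ^ (Suc N * s) - (1 + q ^ N) * q ^ (N * s)) * shanks_coeff q s)
       = - (q ^ (N * Suc m) * shanks_coeff q m * (1 + q ^ m))"
proof (induction m)
  case 0
  then show ?case by (simp add: shanks_coeff_def algebra_simps)
next
  case (Suc m)
  let ?c = "shanks_coeff q (Suc m)" and ?Q = "q ^ (N * Suc m)" and ?r = "q ^ Suc m"
  have "((1 - q ^ N) * q ^ (Suc N * Suc m) - (1 + q ^ N) * ?Q) * ?c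
      - ?Q * (shanks_coeff q m * (1 + q ^ m))
      = ((1 - q ^ N) * (?Q * ?r) - (1 + q ^ N) * ?Q) * ?c + ?Q * (?c * (1 - ?r))"
    unfolding shanks_coeff_Suc[OF assms] by (simp add: power_add algebra_simps)
  also have "\<dots> = - (?Q * q ^ N * ?c * (1 + ?r))"
    by algebra
  also have "?Q * q ^ N = q ^ (N * Suc (Suc m))"
    by (simp add: power_add algebra_simps)
  finally show ?case
    unfolding sum.atMost_Suc Suc.IH by (simp only: mult.assoc uminus_add_conv_diff)
qed

text \<open>Shanks' finite form of Gauss's identity: only the term \<open>s = 0\<close> survives as
  \<open>n\<close> tends to infinity.\<close>
lemma shanks_identity:
  assumes "norm q < 1"
  shows "1 + 2 * (\<Sum>j\<in>{1..n}. (-1) ^ j * q ^ (j\<^sup>2))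
       = gauss_prod q n * (\<Sum>s\<le>n. q ^ (Suc n * s) * shanks_coeff q s)"
proof (induction n)
  case 0
  then show ?case by (simp add: shanks_coeff_def gauss_prod_def)
next
  case (Suc n)
  let ?N = "Suc n"
  let ?c = "shanks_coeff q"
  define x where "x = q ^ ?N"
  define S where "S = (\<Sum>s\<le>n. q ^ (Suc ?N * s) * ?c s)"
  define T where "T = (\<Sum>s\<le>n. q ^ (?N * s) * ?c s)"
  have nz: "1 - x \<noteq> 0" "1 + x \<noteq> 0"
    unfolding x_def using one_minus_power_nonzero[OF assms, of "Suc n"] by auto
  define Q where "Q = q ^ (?N * ?N)"
  have tel: "(1 - x) * S - (1 + x) * T = - (Q * ?c n * (1 + q ^ n))"
    using shanks_telescope[OF assms, where m = n and N = ?N]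
    by (simp only: x_def S_def T_def Q_def sum_distrib_left left_diff_distrib sum_subtractf mult.assoc)
  have last: "?c ?N * (1 - x) = - ?c n * (1 + q ^ n)"
    unfolding x_def by (rule shanks_coeff_Suc[OF assms])
  have G: "gauss_prod q ?N = gauss_prod q n * (1 - x) / (1 + x)"
    by (simp add: gauss_prod_def x_def)
  have U: "(\<Sum>s\<le>?N. q ^ (Suc ?N * s) * ?c s) = S + Q * x * ?c ?N"
    by (simp add: S_def Q_def x_def power_add algebra_simps)
  \<comment> \<open>The new top term s = n + 1 is what makes the right-hand side divisible by 1 + x.
    The remaining correction, multiplied by \<open>gauss_prod q n\<close>, is the new theta term
    with exponent (n + 1)^2.\<close>
  have "(1 - x) * (S + Q * x * ?c ?N) = (1 + x) * T - Q * ?c n * (1 + q ^ n) + Q * x * (?c ?N * (1 - x))"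
    using tel by (simp add: algebra_simps)
  also have "\<dots> = (1 + x) * (T - Q * (?c n * (1 + q ^ n)))"
    unfolding last by (simp add: algebra_simps)
  finally have "gauss_prod q ?N * (\<Sum>s\<le>?N. q ^ (Suc ?N * s) * ?c s)
     = gauss_prod q n * (T - Q * (?c n * (1 + q ^ n)))"
    unfolding G U using nz by (simp add: divide_eq_eq mult_ac)
  also have "\<dots> = gauss_prod q n * T - Q * (?c n * (1 + q ^ n) * gauss_prod q n)"
    by (simp add: algebra_simps)
  also have "\<dots> = gauss_prod q n * T - Q * (2 * (-1) ^ n)"
    by (simp only: shanks_coeff_gauss_prod[OF assms])
  finally show ?case
    using Suc.IH by (simp add: T_def Q_def power2_eq_square algebra_simps)
qed

lemma gauss_prod_limit:
  assumes "norm q < 1"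
  shows "gauss_prod q \<longlonglongrightarrow> qpochhammer_inf q q / qpochhammer_inf (-q) q"
proof -
  have "(\<lambda>n. (\<Prod>k<n. 1 - 1 * q ^ Suc k) / (\<Prod>k<n. 1 - (-1) * q ^ Suc k))
      \<longlonglongrightarrow> qpochhammer_inf (1 * q) q / qpochhammer_inf ((-1) * q) q"
    by (intro tendsto_divide qpochhammer_inf_diag assms) auto
  then show ?thesis
    by (simp add: gauss_prod_def[abs_def] prod_dividef)
qed

lemma gauss_quotient_nonzero:
  assumes "norm q < 1"
  shows "qpochhammer_inf q q / qpochhammer_inf (-q) q \<noteq> 0"
  using qpochhammer_inf_diag(1)[OF assms, of 1] qpochhammer_inf_diag(1)[OF assms, of "-1"] by auto

text \<open>\<open>shanks_coeff_gauss_prod\<close> expresses the coefficient through 1 /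
  \<open>gauss_prod\<close>, which is bounded because the limit of \<open>gauss_prod\<close> is
  nonzero. The summand 1 in the bound covers s = 0.\<close>

lemma shanks_coeff_bounded:
  assumes "norm q < 1"
  shows "\<exists>M. \<forall>s. norm (shanks_coeff q s) \<le> M"
proof -
  have "(\<lambda>n. inverse (gauss_prod q n)) \<longlonglongrightarrow> inverse (qpochhammer_inf q q / qpochhammer_inf (-q) q)"
    by (intro tendsto_inverse gauss_prod_limit gauss_quotient_nonzero assms)
  then have "Bseq (\<lambda>n. inverse (gauss_prod q n))"
    by (intro convergent_imp_Bseq convergentI)
  then obtain B where B: "B > 0" "\<And>n. norm (inverse (gauss_prod q n)) \<le> B"
    by (auto elim: BseqE)
  have "norm (shanks_coeff q s) \<le> 1 + 2 * B / (1 - norm q)" for s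
  proof (cases "s = 0")
    case True
    then show ?thesis using B assms by (simp add: shanks_coeff_def)
  next
    case False
    have "1 + q ^ s \<noteq> 0" using one_minus_power_nonzero[OF assms, of s] False by auto
    moreover have "gauss_prod q s \<noteq> 0"
      using one_minus_power_nonzero[OF assms] by (simp add: gauss_prod_def del: power_Suc)
    ultimately have "shanks_coeff q s = 2 * (-1) ^ s * inverse (gauss_prod q s) / (1 + q ^ s)"
      using shanks_coeff_gauss_prod[OF assms, of s]
      by (metis divide_inverse nonzero_eq_divide_eq)
    then have "norm (shanks_coeff q s) = 2 * norm (inverse (gauss_prod q s)) / norm (1 + q ^ s)"
      by (simp add: norm_divide norm_mult norm_power)
    also have "\<dots> \<le> 2 * B / (1 - norm q)"
    proof (rule frac_le)
      have "norm (q ^ s) \<le> norm q"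
        using False assms power_decreasing[of 1 s "norm q"] by (simp add: norm_power)
      moreover have "1 - norm (q ^ s) \<le> norm (1 + q ^ s)"
        by (metis norm_diff_ineq norm_one)
      ultimately show "1 - norm q \<le> norm (1 + q ^ s)" by linarith
    qed (use B assms in auto)
    finally show ?thesis by simp
  qed
  then show ?thesis by blast
qed

lemma gauss_partial_sums_limit:
  assumes "norm q < 1"
  shows "(\<lambda>n. 1 + 2 * (\<Sum>j\<in>{1..n}. (-1) ^ j * q ^ (j\<^sup>2)))
           \<longlonglongrightarrow> qpochhammer_inf q q / qpochhammer_inf (-q) q"
proof -
  obtain M where M: "\<And>s. norm (shanks_coeff q s) \<le> M"
    using shanks_coeff_bounded[OF assms] by blast
  have M0: "M \<ge> 0" using M[of 0] norm_ge_zero order_trans by blast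
  define U where "U = (\<lambda>n. \<Sum>s\<le>n. q ^ (Suc n * s) * shanks_coeff q s)"
  have "norm (U n - 1) \<le> norm q ^ n * (M / (1 - norm q))" for n
  proof -
    have "U n = 1 + (\<Sum>s\<in>{1..n}. q ^ (Suc n * s) * shanks_coeff q s)"
      unfolding U_def
      by (subst sum.atMost_shift) (simp add: shanks_coeff_def[of _ 0] sum.atLeast1_atMost_eq add.left_commute)
    then have "norm (U n - 1) \<le> (\<Sum>s\<in>{1..n}. norm (q ^ (Suc n * s) * shanks_coeff q s))"
      using norm_sum by simp
    also have "\<dots> \<le> (\<Sum>s\<in>{1..n}. norm q ^ n * M * norm q ^ s)"
    proof (rule sum_mono)
      fix s assume s: "s \<in> {1..n}"
      \<comment> \<open>For s \<ge> 1 one has (n + 1) s \<ge> n + s, so a factor |q|^n comes out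
        uniformly and a geometric series remains.\<close>
      have "norm q ^ (Suc n * s) \<le> norm q ^ (n + s)"
        using s assms by (intro power_decreasing) auto
      then show "norm (q ^ (Suc n * s) * shanks_coeff q s) \<le> norm q ^ n * M * norm q ^ s"
        unfolding norm_mult norm_power
        using mult_mono[OF _ M[of s], of "norm q ^ (Suc n * s)" "norm q ^ (n + s)"]
        by (simp add: power_add mult_ac)
    qed
    also have "\<dots> = norm q ^ n * M * (\<Sum>s\<in>{1..n}. norm q ^ s)"
      by (simp add: sum_distrib_left)
    also have "\<dots> \<le> norm q ^ n * M * (\<Sum>s. norm q ^ s)"
      using M0 assms by (intro mult_left_mono sum_le_suminf summable_geometric) auto
    also have "\<dots> = norm q ^ n * (M / (1 - norm q))"
      using assms by (simp add: suminf_geometric)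
    finally show ?thesis .
  qed
  moreover have "(\<lambda>n. norm q ^ n * (M / (1 - norm q))) \<longlonglongrightarrow> 0"
    using assms by (intro tendsto_mult_left_zero[OF LIMSEQ_realpow_zero]) auto
  ultimately have "(\<lambda>n. U n - 1) \<longlonglongrightarrow> 0"
    by (rule Lim_null_comparison[OF always_eventually, rule_format])
  then have "U \<longlonglongrightarrow> 1" by (simp add: LIM_zero_iff)
  from tendsto_mult[OF gauss_prod_limit[OF assms] this]
  show ?thesis by (simp only: U_def shanks_identity[OF assms] mult_1_right)
qed

section \<open>Theta series\<close>

text \<open>Domination by a product of one-variable series; it is the source of the double
  summability that the interchanges of summation below rely on.\<close>

lemma summable_on_prod_bound:
  fixes f :: "'a \<times> 'b \<Rightarrow> 'c :: banach" and a :: "'a \<Rightarrow> real" and b :: "'b \<Rightarrow> real"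
  assumes a: "a summable_on A" and b: "b summable_on B"
    and a0: "\<And>x. x \<in> A \<Longrightarrow> 0 \<le> a x" and b0: "\<And>y. y \<in> B \<Longrightarrow> 0 \<le> b y"
    and le: "\<And>x y. x \<in> A \<Longrightarrow> y \<in> B \<Longrightarrow> norm (f (x, y)) \<le> a x * b y"
  shows "f summable_on A \<times> B"
proof -
  have "(\<lambda>(x, y). a x * b y) summable_on A \<times> B"
  proof (rule summable_on_SigmaI)
    show "((\<lambda>y. case (x, y) of (x, y) \<Rightarrow> a x * b y) has_sum a x * infsum b B) B" for x
      using b by (auto intro!: has_sum_cmult_right has_sum_infsum)
    show "(\<lambda>x. a x * infsum b B) summable_on A"
      by (intro summable_on_cmult_left a)
  qed (use a0 b0 in auto)
  then have "(\<lambda>p. norm (f p)) summable_on A \<times> B"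
    using le by (intro Infinite_Sum.abs_summable_on_comparison_test'[where g = "\<lambda>(x, y). a x * b y"]) auto
  then show ?thesis by (rule abs_summable_summable)
qed

lemma infsum_mult_prod:
  fixes f :: "'a \<Rightarrow> complex" and g :: "'b \<Rightarrow> complex"
  assumes "(\<lambda>x. norm (f x)) summable_on A" "(\<lambda>x. norm (g x)) summable_on B"
  shows "(\<lambda>(x, y). f x * g y) summable_on A \<times> B"
    and "(\<Sum>\<^sub>\<infinity>(x, y)\<in>A \<times> B. f x * g y) = infsum f A * infsum g B"
proof -
  show S: "(\<lambda>(x, y). f x * g y) summable_on A \<times> B"
    by (rule summable_on_prod_bound[OF assms]) (auto simp: norm_mult)
  have "f summable_on A" "g summable_on B"
    using assms abs_summable_summable by blast+
  then show "(\<Sum>\<^sub>\<infinity>(x, y)\<in>A \<times> B. f x * g y) = infsum f A * infsum g B"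
    by (subst infsum_Sigma'_banach[symmetric, OF S])
       (simp add: infsum_cmult_right infsum_cmult_left)
qed

section \<open>Shifts, reflections and splittings of sums over the integers\<close>

lemma infsum_int_shift: "(\<Sum>\<^sub>\<infinity>k. f (k + a)) = (\<Sum>\<^sub>\<infinity>k::int. f k)"
  by (rule infsum_reindex_bij_witness[of _ "\<lambda>k. k - a" "\<lambda>k. k + a"]) auto

lemma summable_int_shift: "(\<lambda>k. f (k + a)) summable_on UNIV \<longleftrightarrow> f summable_on (UNIV :: int set)"
  by (rule summable_on_reindex_bij_witness[of _ "\<lambda>k. k - a" "\<lambda>k. k + a"]) auto

lemma infsum_int_reflect: "(\<Sum>\<^sub>\<infinity>k. f (a - k)) = (\<Sum>\<^sub>\<infinity>k::int. f k)"
  by (rule infsum_reindex_bij_witness[of _ "\<lambda>k. a - k" "\<lambda>k. a - k"]) auto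

lemma summable_int_reflect: "(\<lambda>k. f (a - k)) summable_on UNIV \<longleftrightarrow> f summable_on (UNIV :: int set)"
  by (rule summable_on_reindex_bij_witness[of _ "\<lambda>k. a - k" "\<lambda>k. a - k"]) auto

lemma infsum_int_even: "(\<Sum>\<^sub>\<infinity>k. if even k then f k else 0) = (\<Sum>\<^sub>\<infinity>k::int. f (2 * k))"
proof -
  have "(\<Sum>\<^sub>\<infinity>k. if even k then f k else 0) = infsum f {k. even k}"
    by (rule infsum_cong_neutral) auto
  also have "\<dots> = (\<Sum>\<^sub>\<infinity>k. f (2 * k))"
    by (rule infsum_reindex_bij_witness[of _ "\<lambda>k. 2 * k" "\<lambda>k. k div 2"]) auto
  finally show ?thesis .
qed

lemma infsum_int_split:
  fixes f :: "int \<Rightarrow> complex"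
  assumes "f summable_on UNIV"
  shows "infsum f UNIV = f 0 + (\<Sum>\<^sub>\<infinity>n::nat\<in>{1..}. f (int n) + f (- int n))"
    and "(\<lambda>n. f (int n) + f (- int n)) summable_on {1..}"
proof -
  have sub: "f summable_on A" for A
    using assms summable_on_subset_banach by blast
  have "((\<lambda>n. f (int n)) has_sum s) {1..} \<longleftrightarrow> (f has_sum s) {1..}" for s
    by (rule has_sum_reindex_bij_witness[of _ nat int]) auto
  then have p: "((\<lambda>n. f (int n)) has_sum infsum f {1..}) {1..}"
    using sub by simp
  have "((\<lambda>n. f (- int n)) has_sum s) {1..} \<longleftrightarrow> (f has_sum s) {..-1}" for s
    by (rule has_sum_reindex_bij_witness[of _ "\<lambda>n. nat (- n)" "\<lambda>n. - int n"]) auto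
  then have m: "((\<lambda>n. f (- int n)) has_sum infsum f {..-1}) {1..}"
    using sub by simp
  note pm = has_sum_add[OF p m]
  show "(\<lambda>n. f (int n) + f (- int n)) summable_on {1..}"
    using pm has_sum_imp_summable by blast
  have "(f has_sum f 0 + (infsum f {1..} + infsum f {..-1})) (insert 0 ({1..} \<union> {..-1}))"
    using sub by (intro has_sum_insert has_sum_Un_disjoint has_sum_infsum) auto
  moreover have "insert 0 ({1..} \<union> {..-1}) = (UNIV :: int set)" by auto
  ultimately show "infsum f UNIV = f 0 + (\<Sum>\<^sub>\<infinity>n::nat\<in>{1..}. f (int n) + f (- int n))"
    using infsumI[OF pm] by (simp add: infsumI)
qed

lemma summable_power_abs_int:
  fixes r :: real
  assumes "0 \<le> r" "r < 1"
  shows "(\<lambda>k::int. r ^ nat \<bar>k\<bar>) summable_on UNIV"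
proof -
  have g: "(\<lambda>n. r ^ n) summable_on (UNIV :: nat set)"
    using assms by (intro summable_nonneg_imp_summable_on summable_geometric) auto
  have "(\<lambda>k::int. r ^ nat \<bar>k\<bar>) summable_on {0..}"
    using g by (subst summable_on_reindex_bij_witness[of _ int nat UNIV "\<lambda>n. r ^ n"]) auto
  moreover have "(\<lambda>k::int. r ^ nat \<bar>k\<bar>) summable_on {..0}"
    using g by (subst summable_on_reindex_bij_witness[of _ "\<lambda>n. - int n" "\<lambda>k. nat (- k)" UNIV "\<lambda>n. r ^ n"]) auto
  ultimately have "(\<lambda>k::int. r ^ nat \<bar>k\<bar>) summable_on ({0..} \<union> {..0})"
    by (rule summable_on_union)
  moreover have "{0..} \<union> {..0} = (UNIV :: int set)" by auto
  ultimately show ?thesis by simp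
qed

text \<open>Excluding 0 makes integer powers additive in the exponent, which \<open>powi\<close>
  does not satisfy at base 0.\<close>

definition nome :: "complex \<Rightarrow> bool" where
  "nome q \<longleftrightarrow> q \<noteq> 0 \<and> norm q < 1"

lemma nome_uminus: "nome q \<Longrightarrow> nome (- q)"
  and nome_power: "nome q \<Longrightarrow> n > 0 \<Longrightarrow> nome (q ^ n)"
  by (auto simp: nome_def norm_power power_less_one_iff)

text \<open>The linear term serves a = 1, which arises when a theta index is shifted, and a = -2,
  which arises from the growth allowed by \<open>norm_fermi_le\<close>.\<close>

lemma summable_norm_quadratic:
  assumes "nome q"
  shows "(\<lambda>k::int. norm (q powi (k\<^sup>2 + a * k))) summable_on UNIV"
proof -
  define r where "r = norm q"
  have r: "0 < r" "r < 1" using assms by (auto simp: r_def nome_def)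
  \<comment> \<open>Chosen so that k^2 + a k \<ge> |k| - C: the product |k| (|a| + 1) is at most C
    when |k| \<le> |a| + 1, and at most k^2 otherwise.\<close>
  define C where "C = (\<bar>a\<bar> + 1)\<^sup>2"
  have bound: "norm (q powi (k\<^sup>2 + a * k)) \<le> r powi (- C) * r ^ nat \<bar>k\<bar>" for k
  proof -
    have "\<bar>k\<bar> * (\<bar>a\<bar> + 1) \<le> k\<^sup>2 + (\<bar>a\<bar> + 1)\<^sup>2"
    proof (cases "\<bar>k\<bar> \<le> \<bar>a\<bar> + 1")
      case True
      then have "\<bar>k\<bar> * (\<bar>a\<bar> + 1) \<le> (\<bar>a\<bar> + 1) * (\<bar>a\<bar> + 1)" by (intro mult_right_mono) auto
      then show ?thesis by (simp add: power2_eq_square add_increasing)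
    next
      case False
      then have "\<bar>k\<bar> * (\<bar>a\<bar> + 1) \<le> \<bar>k\<bar> * \<bar>k\<bar>" by (intro mult_left_mono) auto
      then show ?thesis by (simp add: power2_eq_square add_increasing2)
    qed
    moreover have "- (a * k) \<le> \<bar>k\<bar> * \<bar>a\<bar>"
      by (metis abs_ge_minus_self abs_mult mult.commute)
    ultimately have "- C + \<bar>k\<bar> \<le> k\<^sup>2 + a * k"
      by (simp add: C_def algebra_simps)
    then have "r powi (k\<^sup>2 + a * k) \<le> r powi (- C + \<bar>k\<bar>)"
      using r by (intro power_int_decreasing) auto
    also have "\<dots> = r powi (- C) * r ^ nat \<bar>k\<bar>"
      using r by (subst power_int_add) (auto simp: power_int_nonneg_exp)
    finally show ?thesis by (simp add: r_def norm_power_int)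
  qed
  have "(\<lambda>k. r powi (- C) * r ^ nat \<bar>k\<bar>) summable_on (UNIV :: int set)"
    using r by (intro summable_on_cmult_right summable_power_abs_int) auto
  from this bound show ?thesis
    by (rule Infinite_Sum.abs_summable_on_comparison_test')
qed

definition theta :: "complex \<Rightarrow> complex" where
  "theta q = (\<Sum>\<^sub>\<infinity>k::int. q powi (k\<^sup>2))"

lemma summable_norm_theta: "nome q \<Longrightarrow> (\<lambda>k::int. norm (q powi (k\<^sup>2))) summable_on UNIV"
  using summable_norm_quadratic[of q 0] by simp

lemma summable_theta: "nome q \<Longrightarrow> (\<lambda>k::int. q powi (k\<^sup>2)) summable_on UNIV"
  by (rule abs_summable_summable[OF summable_norm_theta])

lemma powi_uminus: "(- q) powi k = (-1) powi k * (q :: complex) powi k"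
  using power_int_mult_distrib[of "-1" q k] by simp

lemma minus_one_powi_sq: "(-1 :: complex) powi (k\<^sup>2) = (-1) powi k"
  by (cases "even k") auto

lemma theta_uminus: "theta (- q) = (\<Sum>\<^sub>\<infinity>k::int. (-1) powi k * q powi (k\<^sup>2))"
  unfolding theta_def by (subst powi_uminus) (simp only: minus_one_powi_sq)

lemma theta_nat:
  assumes "nome q"
  shows "theta q = 1 + 2 * (\<Sum>\<^sub>\<infinity>n\<in>{1..}. q ^ (n\<^sup>2))"
    and "(\<lambda>n. q ^ (n\<^sup>2)) summable_on {1..}"
proof -
  have e: "q powi ((int n)\<^sup>2) = q ^ n\<^sup>2" for n
    by (metis of_nat_power power_int_of_nat)
  have "(\<lambda>n. 2 * q ^ (n\<^sup>2)) summable_on {1..}"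
    using infsum_int_split(2)[OF summable_theta[OF assms]] by (simp add: e)
  then show "(\<lambda>n. q ^ (n\<^sup>2)) summable_on {1..}"
    by (simp add: summable_on_cmult_right')
  then show "theta q = 1 + 2 * (\<Sum>\<^sub>\<infinity>n\<in>{1..}. q ^ (n\<^sup>2))"
    unfolding theta_def infsum_int_split(1)[OF summable_theta[OF assms]]
    by (simp add: e infsum_cmult_right)
qed

lemma theta_gauss:
  assumes "nome q"
  shows "theta (- q) = qpochhammer_inf q q / qpochhammer_inf (- q) q"
proof -
  have "((\<lambda>n. (- q) ^ (n\<^sup>2)) has_sum (theta (- q) - 1) / 2) {1..}"
    using theta_nat[OF nome_uminus[OF assms]] by (simp add: has_sum_iff)
  then have "((\<lambda>n. (- q) ^ ((Suc n)\<^sup>2)) has_sum (theta (- q) - 1) / 2) UNIV"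
    by (subst has_sum_reindex_bij_witness[of _ "\<lambda>n. n - 1" Suc "{1..}" "\<lambda>n. (- q) ^ (n\<^sup>2)"]) auto
  then have "(\<lambda>n. (- q) ^ ((Suc n)\<^sup>2)) sums ((theta (- q) - 1) / 2)"
    by (rule has_sum_imp_sums)
  then have "(\<lambda>n. 1 + 2 * (\<Sum>j<n. (- q) ^ ((Suc j)\<^sup>2))) \<longlonglongrightarrow> 1 + 2 * ((theta (- q) - 1) / 2)"
    unfolding sums_def by (intro tendsto_intros)
  moreover have "(\<Sum>j<n. (- q) ^ ((Suc j)\<^sup>2)) = (\<Sum>j\<in>{1..n}. (-1) ^ j * q ^ (j\<^sup>2))" for n
  proof -
    have "(- q) ^ (j\<^sup>2) = (-1) ^ j * q ^ (j\<^sup>2)" for j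
      by (cases "even j") auto
    then show ?thesis by (simp only: sum.atLeast1_atMost_eq One_nat_def)
  qed
  moreover have "1 + 2 * ((theta (- q) - 1) / 2) = theta (- q)" by (simp add: field_simps)
  ultimately have "(\<lambda>n. 1 + 2 * (\<Sum>j\<in>{1..n}. (-1) ^ j * q ^ (j\<^sup>2))) \<longlonglongrightarrow> theta (- q)"
    by (simp only:)
  then show ?thesis
    using assms unfolding nome_def by (intro LIMSEQ_unique[OF _ gauss_partial_sums_limit]) auto
qed

text \<open>Gauss's product is applied at the nome -q. Every later cancellation of a theta factor
  rests on this.\<close>

lemma theta_nonzero:
  assumes "nome q"
  shows "theta q \<noteq> 0"
  using theta_gauss[OF nome_uminus[OF assms]] gauss_quotient_nonzero[of "- q"] assms
  by (simp add: nome_def)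

section \<open>Theta times a hyperbolic secant\<close>

text \<open>For q = exp(-x) this is 1 / (2 cosh(j x)), the \<open>v_j\<close> of the overview; its
  value at 0 is 1/2.\<close>

definition sech_coeff :: "complex \<Rightarrow> int \<Rightarrow> complex" where
  "sech_coeff q j = q powi j / (1 + q powi (2 * j))"

text \<open>For q = exp(-x) this is the Fermi function 1 / (exp(2 j x) + 1), the \<open>y_j\<close>
  of the overview, and 1 - 2 \<open>fermi\<close> is tanh(j x). It tends to 1 as j tends to minus
  infinity.\<close>

definition fermi :: "complex \<Rightarrow> int \<Rightarrow> complex" where
  "fermi q j = q powi (2 * j) / (1 + q powi (2 * j))"

lemma one_plus_powi_bound:
  assumes "nome q" "j \<ge> 0"
  shows "1 - (norm q)\<^sup>2 \<le> norm (1 + q powi (2 * j))"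
proof (cases "j = 0")
  case True
  then show ?thesis by (simp add: add_increasing order_trans[of _ 1])
next
  case False
  have "norm q powi (2 * j) \<le> norm q powi 2"
    using assms False by (intro power_int_decreasing) (auto simp: nome_def)
  then have "norm (q powi (2 * j)) \<le> (norm q)\<^sup>2" by (simp add: norm_power_int)
  moreover have "1 - norm (q powi (2 * j)) \<le> norm (1 + q powi (2 * j))"
    by (metis norm_diff_ineq norm_one)
  ultimately show ?thesis by linarith
qed

lemma nome_sq_less: "nome q \<Longrightarrow> (norm q)\<^sup>2 < 1"
  by (simp add: nome_def power_less_one_iff)

lemma one_plus_powi_nonzero:
  assumes "nome q"
  shows "1 + q powi (2 * j) \<noteq> 0"
proof (cases "j \<ge> 0")
  case True
  show ?thesis
    using one_plus_powi_bound[OF assms True] nome_sq_less[OF assms] by auto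
next
  case False
  have "1 + q powi (2 * (- j)) \<noteq> 0"
    using one_plus_powi_bound[OF assms, of "- j"] nome_sq_less[OF assms] False by auto
  moreover have "q powi (2 * j) \<noteq> 0" using assms by (simp add: nome_def)
  ultimately show ?thesis
    by (simp add: power_int_minus field_simps add.commute)
qed

lemma one_minus_powi_nonzero:
  assumes "nome q" "j \<noteq> 0"
  shows "1 - q powi (2 * j) \<noteq> 0"
proof
  assume "1 - q powi (2 * j) = 0"
  then have 1: "norm q powi (2 * j) = 1"
    by (metis eq_iff_diff_eq_0 norm_one norm_power_int)
  have q: "0 < norm q" "norm q < 1" using assms by (auto simp: nome_def)
  show False
  proof (cases "j > 0")
    case True
    then have "norm q powi (2 * j) < norm q powi 0"
      using q by (intro power_int_strict_decreasing) auto
    then show False using 1 by simp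
  next
    case False
    then have "norm q powi 0 < norm q powi (2 * j)"
      using q assms(2) by (intro power_int_strict_decreasing) auto
    then show False using 1 by simp
  qed
qed

lemma powi_double: "(q :: complex) powi (2 * j) = (q powi j)\<^sup>2"
  by (simp add: power_int_power' mult.commute)

lemma sech_coeff_minus:
  assumes "nome q"
  shows "sech_coeff q (- j) = sech_coeff q j"
proof -
  define x where "x = q powi j"
  have x: "x \<noteq> 0" "1 + x\<^sup>2 \<noteq> 0"
    using assms one_plus_powi_nonzero[OF assms, of j] by (auto simp: x_def nome_def powi_double)
  have "inverse x / (1 + inverse (x\<^sup>2)) = x / (1 + x\<^sup>2)"
    using x by (simp add: divide_simps add.commute power2_eq_square)
  then show ?thesis
    by (simp add: sech_coeff_def power_int_minus powi_double flip: x_def)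
qed

lemma fermi_minus: "nome q \<Longrightarrow> fermi q (- j) = 1 - fermi q j"
  using one_plus_powi_nonzero[of q j] one_plus_powi_nonzero[of q "- j"]
  by (simp add: fermi_def nome_def power_int_minus divide_simps add.commute)

lemma sech_coeff_uminus: "sech_coeff (- q) j = (-1) powi j * sech_coeff q j"
  unfolding sech_coeff_def by (subst (1 2) powi_uminus) simp

lemma norm_sech_coeff_le:
  assumes "nome q"
  shows "norm (sech_coeff q j) \<le> norm q ^ nat \<bar>j\<bar> / (1 - (norm q)\<^sup>2)"
proof -
  have "norm (sech_coeff q j) = norm (sech_coeff q \<bar>j\<bar>)"
    by (cases "j \<ge> 0") (auto simp: sech_coeff_minus[OF assms])
  also have "\<dots> = norm q ^ nat \<bar>j\<bar> / norm (1 + q powi (2 * \<bar>j\<bar>))"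
    by (simp add: sech_coeff_def norm_divide norm_power power_int_nonneg_exp)
  also have "\<dots> \<le> norm q ^ nat \<bar>j\<bar> / (1 - (norm q)\<^sup>2)"
    using one_plus_powi_bound[OF assms, of "\<bar>j\<bar>"] nome_sq_less[OF assms] by (intro divide_left_mono) (auto intro!: mult_pos_pos simp: one_plus_powi_nonzero[OF assms])
  finally show ?thesis .
qed

lemma summable_norm_sech:
  assumes "nome q"
  shows "(\<lambda>j. norm (sech_coeff q j)) summable_on UNIV"
proof (rule Infinite_Sum.abs_summable_on_comparison_test'[OF _ norm_sech_coeff_le[OF assms]])
  show "(\<lambda>j::int. norm q ^ nat \<bar>j\<bar> / (1 - (norm q)\<^sup>2)) summable_on UNIV"
    using summable_on_cmult_left[OF summable_power_abs_int[of "norm q"], of "inverse (1 - (norm q)\<^sup>2)"] assms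
    by (simp add: nome_def divide_inverse)
qed

lemma sech_bounded:
  assumes "nome q"
  obtains B where "\<And>j. norm (sech_coeff q j) \<le> B" "0 \<le> B"
proof
  fix j
  show "norm (sech_coeff q j) \<le> 1 / (1 - (norm q)\<^sup>2)"
  proof (rule order_trans[OF norm_sech_coeff_le[OF assms]])
    show "norm q ^ nat \<bar>j\<bar> / (1 - (norm q)\<^sup>2) \<le> 1 / (1 - (norm q)\<^sup>2)"
      using assms nome_sq_less[OF assms] by (intro divide_right_mono) (auto simp: nome_def power_le_one)
  qed
  show "0 \<le> 1 / (1 - (norm q)\<^sup>2)" using nome_sq_less[OF assms] by simp
qed

lemma minus_one_powi_diff: "(-1 :: complex) powi (a - b) = (-1) powi a * (-1) powi b"
  by (cases "even a"; cases "even b") auto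

lemma norm_minus_one_powi [simp]: "norm ((-1 :: complex) powi k) = 1"
  by (simp add: norm_power_int)

text \<open>At n = 0 this is the \<open>g\<close> of the overview, because \<open>sech_coeff\<close>
  is even. The extra index n provides a recursion.\<close>

definition theta_sech :: "complex \<Rightarrow> int \<Rightarrow> complex" where
  "theta_sech q n = (\<Sum>\<^sub>\<infinity>k. (-1) powi k * q powi (k\<^sup>2) * sech_coeff q (n - k))"

lemma summable_norm_theta_sech:
  assumes "nome q"
  shows "(\<lambda>k. norm ((-1) powi k * q powi (k\<^sup>2 + a * k) * sech_coeff q (n - k))) summable_on UNIV"
proof -
  obtain B where B: "\<And>j. norm (sech_coeff q j) \<le> B" "0 \<le> B"
    using sech_bounded[OF assms] by blast
  show ?thesis
  proof (rule Infinite_Sum.abs_summable_on_comparison_test')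
    show "(\<lambda>k. norm (q powi (k\<^sup>2 + a * k)) * B) summable_on UNIV"
      by (intro summable_on_cmult_left summable_norm_quadratic assms)
    show "norm ((-1) powi k * q powi (k\<^sup>2 + a * k) * sech_coeff q (n - k))
        \<le> norm (q powi (k\<^sup>2 + a * k)) * B" for k
      unfolding norm_mult by (simp add: mult_left_mono B)
  qed
qed

lemmas summable_theta_sech = abs_summable_summable[OF summable_norm_theta_sech]

text \<open>After the shift k \<mapsto> k + 1 the relation q^(-2j) v_j = q^(-j) - v_j returns the
  old series plus a series without any v, and the latter sums to zero.\<close>

lemma theta_sech_Suc:
  assumes "nome q"
  shows "theta_sech q (n + 1) = q powi (2 * n + 1) * theta_sech q n"
proof -
  have q: "q \<noteq> 0" using assms by (simp add: nome_def)
  define c where "c = - (q powi (n + 1))"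
  define A where "A = (\<lambda>k. (-1) powi k * q powi (k\<^sup>2) * sech_coeff q (n - k))"
  define C where "C = (\<lambda>k::int. (-1) powi k * q powi (k\<^sup>2 + 1 * k))"
  have shifted: "(-1) powi (k + 1) * q powi ((k + 1)\<^sup>2) * sech_coeff q (n + 1 - (k + 1))
      = q powi (2 * n + 1) * A k - q powi (n + 1) * C k" for k
  proof -
    define j where "j = n - k"
    have "q powi (- 2 * j) * sech_coeff q j = q powi (- j) - sech_coeff q j"
    proof -
      define x where "x = q powi j"
      have x: "x \<noteq> 0" "1 + x\<^sup>2 \<noteq> 0"
        using q one_plus_powi_nonzero[OF assms, of j] by (auto simp: x_def powi_double)
      have "inverse (x\<^sup>2) * (x / (1 + x\<^sup>2)) = inverse x - x / (1 + x\<^sup>2)"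
        using x by (simp add: divide_simps) (simp add: power2_eq_square algebra_simps)
      then show ?thesis
        by (simp add: sech_coeff_def power_int_minus powi_double flip: x_def)
    qed
    then have "q powi (2 * n) * (q powi (- 2 * j) * sech_coeff q j)
        = q powi (2 * n) * q powi (- j) - q powi (2 * n) * sech_coeff q j"
      by (simp only: right_diff_distrib)
    moreover have "q powi (2 * n) * q powi (- 2 * j) = q powi (2 * k)"
      "q powi (2 * n) * q powi (- j) = q powi n * q powi k"
      using q by (auto simp: j_def power_int_add[symmetric] algebra_simps)
    ultimately have *: "q powi (2 * k) * sech_coeff q j = q powi n * q powi k - q powi (2 * n) * sech_coeff q j"
      by (metis mult.assoc)
    have "(k + 1)\<^sup>2 = k\<^sup>2 + (2 * k + 1)" by (simp add: power2_eq_square algebra_simps)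
    then have "q powi ((k + 1)\<^sup>2) = q powi (k\<^sup>2) * q powi (2 * k) * q"
      using q by (simp add: power_int_add)
    then have "(-1) powi (k + 1) * q powi ((k + 1)\<^sup>2) * sech_coeff q (n + 1 - (k + 1))
      = - ((-1) powi k) * q powi (k\<^sup>2) * q * (q powi (2 * k) * sech_coeff q j)"
      by (simp add: j_def power_int_add)
    also have "\<dots> = q powi (2 * n + 1) * A k - q powi (n + 1) * C k"
      unfolding * using q by (simp add: A_def C_def j_def power_int_add algebra_simps)
    finally show ?thesis .
  qed
  have sA: "A summable_on UNIV"
    unfolding A_def using summable_theta_sech[OF assms, of 0] by simp
  have "(\<lambda>k. norm (C k)) summable_on UNIV"
    using summable_norm_quadratic[OF assms, of 1] by (simp add: C_def norm_mult)
  then have sC: "C summable_on UNIV" by (rule abs_summable_summable)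
  \<comment> \<open>The reflection k \<mapsto> -1 - k fixes k^2 + k and flips the parity of
    k.\<close>
  have "C (- 1 - k) = - C k" for k
  proof -
    have e1: "(- 1 - k)\<^sup>2 + 1 * (- 1 - k) = k\<^sup>2 + 1 * k"
      by (simp add: power2_eq_square algebra_simps)
    have e2: "(- 1 :: complex) powi (- 1 - k) = - ((- 1) powi k)"
      by (cases "even k") auto
    show ?thesis unfolding C_def e1 e2 by simp
  qed
  then have "infsum C UNIV = - infsum C UNIV"
    using infsum_int_reflect[of C "- 1"] by (simp add: infsum_uminus)
  then have C0: "infsum C UNIV = 0" by simp
  have "theta_sech q (n + 1)
      = (\<Sum>\<^sub>\<infinity>k. (-1) powi (k + 1) * q powi ((k + 1)\<^sup>2) * sech_coeff q (n + 1 - (k + 1)))"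
    unfolding theta_sech_def by (rule infsum_int_shift[symmetric])
  also have "\<dots> = (\<Sum>\<^sub>\<infinity>k. q powi (2 * n + 1) * A k + c * C k)"
    unfolding shifted by (simp add: c_def)
  also have "\<dots> = q powi (2 * n + 1) * infsum A UNIV + c * infsum C UNIV"
    using sA sC by (subst infsum_add) (auto simp: infsum_cmult_right' intro!: summable_on_cmult_right)
  finally show ?thesis
    by (simp add: C0 A_def theta_sech_def)
qed

text \<open>The exponents 2n + 1 of the recursion are differences of consecutive squares. With the
  dependence on n made explicit, a further sum over n becomes a theta-type series times
  \<open>theta_sech q 0\<close>.\<close>

lemma theta_sech_eq:
  assumes "nome q"
  shows "theta_sech q n = q powi (n\<^sup>2) * theta_sech q 0"
proof (induction n rule: int_induct[where k = 0])
  case base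
  then show ?case by simp
next
  case (step1 i)
  have "(i + 1)\<^sup>2 = (2 * i + 1) + i\<^sup>2" by (simp add: power2_eq_square algebra_simps)
  then show ?case
    using theta_sech_Suc[OF assms, of i] step1 assms by (simp add: nome_def power_int_add)
next
  case (step2 i)
  have "i\<^sup>2 = (2 * (i - 1) + 1) + (i - 1)\<^sup>2" by (simp add: power2_eq_square algebra_simps)
  then have "q powi (i\<^sup>2) = q powi (2 * (i - 1) + 1) * q powi ((i - 1)\<^sup>2)"
    using assms by (metis nome_def power_int_add)
  moreover have "q powi (2 * (i - 1) + 1) \<noteq> 0" using assms by (simp add: nome_def)
  ultimately show ?case
    using theta_sech_Suc[OF assms, of "i - 1"] step2 by simp
qed

definition sech_sum :: "complex \<Rightarrow> complex" where
  "sech_sum q = (\<Sum>\<^sub>\<infinity>j. sech_coeff q j)"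

lemma summable_sech: "nome q \<Longrightarrow> (\<lambda>j. sech_coeff q j) summable_on UNIV"
  by (rule abs_summable_summable[OF summable_norm_sech])

lemma sech_sum_uminus: "sech_sum (- q) = (\<Sum>\<^sub>\<infinity>j. (-1) powi j * sech_coeff q j)"
  by (simp add: sech_sum_def sech_coeff_uminus)

text \<open>The sign of (-q)^(k^2) cancels the sign that the secant acquires. This evenness links
  the values of \<open>sech_sum\<close> at q and -q.\<close>

lemma theta_sech_0_uminus:
  assumes "nome q"
  shows "theta_sech (- q) 0 = theta_sech q 0"
proof -
  have "(-1) powi k * (- q) powi k\<^sup>2 * sech_coeff (- q) (0 - k) =
     (-1) powi k * q powi k\<^sup>2 * sech_coeff q (0 - k)" for k
    by (cases "even k") (auto simp: sech_coeff_uminus powi_uminus[of q "k\<^sup>2"] minus_one_powi_sq)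
  then show ?thesis by (simp only: theta_sech_def)
qed

text \<open>The series \<Sum> (-1)^n \<open>theta_sech q n\<close> is evaluated twice. Over k first,
  \<open>theta_sech_eq\<close> applies; over n first, n \<mapsto> n + k decouples the factors, the
  two signs (-1)^k cancelling.\<close>

lemma theta_sech_sum:
  assumes "nome q"
  shows "theta (- q) * theta_sech q 0 = theta q * sech_sum (- q)"
proof -
  define F where "F = (\<lambda>n k. (-1) powi n * ((-1) powi k * q powi (k\<^sup>2) * sech_coeff q (n - k)))"
  have "(\<lambda>(k, n). q powi (k\<^sup>2) * ((-1) powi n * sech_coeff q n)) summable_on UNIV \<times> UNIV"
    using summable_norm_sech[OF assms]
    by (intro infsum_mult_prod(1) summable_norm_theta assms) (simp add: norm_mult)
  then have "(\<lambda>(n, k). F n k) summable_on UNIV \<times> UNIV"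
  proof (subst summable_on_reindex_bij_witness[of _ "\<lambda>(k, n). (n + k, k)" "\<lambda>(n, k). (k, n - k)"
        "UNIV \<times> UNIV" "\<lambda>(k, n). q powi (k\<^sup>2) * ((-1) powi n * sech_coeff q n)"])
    fix a :: "int \<times> int"
    show "(case case a of (n, k) \<Rightarrow> (k, n - k) of (k, n) \<Rightarrow> q powi k\<^sup>2 * ((- 1) powi n * sech_coeff q n)) =
         (case a of (n, k) \<Rightarrow> F n k)"
      by (auto simp: F_def minus_one_powi_diff power_int_add split: prod.splits)
  qed auto
  then have swap: "(\<Sum>\<^sub>\<infinity>n. \<Sum>\<^sub>\<infinity>k. F n k) = (\<Sum>\<^sub>\<infinity>k. \<Sum>\<^sub>\<infinity>n. F n k)"
    by (rule infsum_swap_banach)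
  have "(\<Sum>\<^sub>\<infinity>k. F n k) = (-1) powi n * q powi (n\<^sup>2) * theta_sech q 0" for n
    by (simp add: F_def infsum_cmult_right' flip: theta_sech_def theta_sech_eq[OF assms])
  then have L: "(\<Sum>\<^sub>\<infinity>n. \<Sum>\<^sub>\<infinity>k. F n k) = theta (- q) * theta_sech q 0"
    by (simp add: theta_uminus infsum_cmult_left')
  have "(\<Sum>\<^sub>\<infinity>n. F n k) = q powi (k\<^sup>2) * sech_sum (- q)" for k
  proof -
    have "(\<Sum>\<^sub>\<infinity>n. F n k) = (\<Sum>\<^sub>\<infinity>n. F (n + k) k)"
      by (rule infsum_int_shift[symmetric])
    also have "\<dots> = (\<Sum>\<^sub>\<infinity>n. q powi (k\<^sup>2) * ((-1) powi n * sech_coeff q n))"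
      by (rule infsum_cong) (simp add: F_def power_int_add)
    finally show ?thesis by (simp add: sech_sum_uminus infsum_cmult_right')
  qed
  then have "(\<Sum>\<^sub>\<infinity>k. \<Sum>\<^sub>\<infinity>n. F n k) = theta q * sech_sum (- q)"
    by (simp add: theta_def infsum_cmult_left')
  with L swap show ?thesis by simp
qed

text \<open>This is tanh a - tanh b = sinh(a - b) / (cosh a cosh b); the prefactor is 1 / (2 sinh(k
  x)) for q = exp(-x).\<close>

lemma sech_mult_shift:
  assumes "nome q" "k \<noteq> 0"
  shows "sech_coeff q n * sech_coeff q (n - k) =
    q powi k / (1 - q powi (2 * k)) * (fermi q (n - k) - fermi q n)"
proof -
  define x where "x = q powi (n - k)"
  define y where "y = q powi k"
  have n: "q powi n = x * y"
    using assms by (simp add: x_def y_def nome_def flip: power_int_add)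
  have x: "1 + x\<^sup>2 \<noteq> 0" using one_plus_powi_nonzero[OF assms(1), of "n - k"] unfolding x_def powi_double .
  have y: "1 - y\<^sup>2 \<noteq> 0" using one_minus_powi_nonzero[OF assms] unfolding y_def powi_double .
  have xy: "1 + (x * y)\<^sup>2 \<noteq> 0" using one_plus_powi_nonzero[OF assms(1), of n] unfolding powi_double n .
  have "x * y / (1 + (x * y)\<^sup>2) * (x / (1 + x\<^sup>2)) = y * (x\<^sup>2 - (x * y)\<^sup>2) / ((1 - y\<^sup>2) * ((1 + x\<^sup>2) * (1 + (x * y)\<^sup>2)))"
    using x y xy by (simp add: frac_eq_eq) (simp add: power2_eq_square algebra_simps)
  also have "x\<^sup>2 - (x * y)\<^sup>2 = x\<^sup>2 * (1 + (x * y)\<^sup>2) - (x * y)\<^sup>2 * (1 + x\<^sup>2)"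
    by (simp add: algebra_simps)
  also have "y * \<dots> / ((1 - y\<^sup>2) * ((1 + x\<^sup>2) * (1 + (x * y)\<^sup>2)))
     = y / (1 - y\<^sup>2) * (x\<^sup>2 / (1 + x\<^sup>2) - (x * y)\<^sup>2 / (1 + (x * y)\<^sup>2))"
    using x xy by (simp add: diff_frac_eq)
  finally show ?thesis
    by (simp only: sech_coeff_def fermi_def powi_double n flip: x_def y_def)
qed

lemma summable_sech_mult_shift:
  assumes "nome q"
  shows "(\<lambda>n. (-1) powi n * sech_coeff q n * sech_coeff q (n - k)) summable_on UNIV"
proof -
  obtain B where B: "\<And>j. norm (sech_coeff q j) \<le> B" "0 \<le> B"
    using sech_bounded[OF assms] by blast
  have "(\<lambda>n. norm ((-1) powi n * sech_coeff q n * sech_coeff q (n - k))) summable_on UNIV"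
  proof (rule Infinite_Sum.abs_summable_on_comparison_test')
    show "(\<lambda>n. norm (sech_coeff q n) * B) summable_on UNIV"
      by (intro summable_on_cmult_left summable_norm_sech assms)
    show "norm ((-1) powi n * sech_coeff q n * sech_coeff q (n - k)) \<le> norm (sech_coeff q n) * B" for n
      by (simp add: norm_mult mult_left_mono B)
  qed
  then show ?thesis by (rule abs_summable_summable)
qed

text \<open>Neither term is summable alone for want of decay at minus infinity. For k \<noteq> 0,
  \<open>sech_mult_shift\<close> read backwards turns the difference into a constant multiple of a
  summable product.\<close>

lemma summable_fermi_diff:
  assumes "nome q"
  shows "(\<lambda>n. (-1) powi n * (fermi q (n - k) - fermi q n)) summable_on UNIV"
proof (cases "k = 0")
  case False
  define c where "c = q powi k / (1 - q powi (2 * k))"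
  have c: "c \<noteq> 0" using one_minus_powi_nonzero[OF assms False] assms by (simp add: c_def nome_def)
  have "(\<lambda>n. (-1) powi n * sech_coeff q n * sech_coeff q (n - k) * inverse c) summable_on UNIV"
    by (intro summable_on_cmult_left summable_sech_mult_shift assms)
  moreover have "(-1) powi n * sech_coeff q n * sech_coeff q (n - k) * inverse c
       = (-1) powi n * (fermi q (n - k) - fermi q n)" for n
    unfolding mult.assoc[of "(-1) powi n"] sech_mult_shift[OF assms False] c_def[symmetric] using c by simp
  ultimately show ?thesis by simp
qed simp

text \<open>Separating the two terms would leave divergent series, so the shift is taken one unit at
  a time: D(k + 1) = D(1) - D(k). The value D(1) equals its own negative under n \<mapsto> 1 - n, by
  \<open>fermi_minus\<close>.\<close>

lemma infsum_fermi_diff: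
  assumes "nome q"
  shows "(\<Sum>\<^sub>\<infinity>n. (-1) powi n * (fermi q (n - k) - fermi q n)) = 0"
proof -
  define D where "D = (\<lambda>k. \<Sum>\<^sub>\<infinity>n. (-1) powi n * (fermi q (n - k) - fermi q n))"
  have "D 1 = (\<Sum>\<^sub>\<infinity>n. (-1) powi (1 - n) * (fermi q ((1 - n) - 1) - fermi q (1 - n)))"
    unfolding D_def by (rule infsum_int_reflect[symmetric])
  also have "\<dots> = (\<Sum>\<^sub>\<infinity>n. - ((-1) powi n * (fermi q (n - 1) - fermi q n)))"
  proof (rule infsum_cong)
    fix n
    have "fermi q (1 - n - 1) = 1 - fermi q n" "fermi q (1 - n) = 1 - fermi q (n - 1)"
      using fermi_minus[OF assms, of n] fermi_minus[OF assms, of "n - 1"] by simp_all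
    then show "(-1) powi (1 - n) * (fermi q ((1 - n) - 1) - fermi q (1 - n)) =
       - ((-1) powi n * (fermi q (n - 1) - fermi q n))"
      by (cases "even n") auto
  qed
  also have "\<dots> = - D 1" by (simp add: D_def infsum_uminus)
  finally have D1: "D 1 = 0" by simp
  have step: "D (k + 1) = - D k" for k
  proof -
    have "D (k + 1) = (\<Sum>\<^sub>\<infinity>n. (-1) powi (n + 1) * (fermi q (n - k) - fermi q n)
         + (-1) powi (n + 1) * (fermi q (n + 1 - 1) - fermi q (n + 1)))"
      unfolding D_def by (subst infsum_int_shift[symmetric, of _ 1]) (simp add: algebra_simps)
    also have "\<dots> = (\<Sum>\<^sub>\<infinity>n. (-1) powi (n + 1) * (fermi q (n - k) - fermi q n))
       + (\<Sum>\<^sub>\<infinity>n. (-1) powi (n + 1) * (fermi q (n + 1 - 1) - fermi q (n + 1)))"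
    proof (rule infsum_add)
      show "(\<lambda>n. (-1) powi (n + 1) * (fermi q (n - k) - fermi q n)) summable_on UNIV"
        using iffD2[OF summable_on_uminus summable_fermi_diff[OF assms, of k]] by (simp add: power_int_add)
      show "(\<lambda>n. (-1) powi (n + 1) * (fermi q (n + 1 - 1) - fermi q (n + 1))) summable_on UNIV"
        by (subst summable_int_shift[where f = "\<lambda>n. (-1) powi n * (fermi q (n - 1) - fermi q n)"])
           (rule summable_fermi_diff[OF assms])
    qed
    also have "(\<Sum>\<^sub>\<infinity>n. (-1) powi (n + 1) * (fermi q (n - k) - fermi q n)) = - D k"
      by (simp add: power_int_add D_def infsum_uminus)
    also have "(\<Sum>\<^sub>\<infinity>n. (-1) powi (n + 1) * (fermi q (n + 1 - 1) - fermi q (n + 1))) = D 1"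
      unfolding D_def by (rule infsum_int_shift[where f = "\<lambda>n. (-1) powi n * (fermi q (n - 1) - fermi q n)"])
    finally show ?thesis using D1 by simp
  qed
  have "D k = 0"
  proof (induction k rule: int_induct[where k = 1])
    case (step2 i)
    then show ?case using step[of "i - 1"] by simp
  qed (use D1 step in auto)
  then show ?thesis by (simp add: D_def)
qed

text \<open>In the double series of v_n v_(n-k) weighted by theta terms, summing over k gives
  \<open>g\<close> times \<Sum> (-1)^n q^(n^2) v_n, again \<open>g\<close>. Summing over n kills
  every k \<noteq> 0 by telescoping, so the diagonal k = 0 is all of it.\<close>

lemma infsum_sech_square:
  assumes "nome q"
  shows "(\<Sum>\<^sub>\<infinity>n. (-1) powi n * (sech_coeff q n)\<^sup>2) = (theta_sech q 0)\<^sup>2"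
proof -
  obtain B where B: "\<And>j. norm (sech_coeff q j) \<le> B" "0 \<le> B"
    using sech_bounded[OF assms] by blast
  define F where "F = (\<lambda>n k. ((-1) powi n * sech_coeff q n) * ((-1) powi k * q powi (k\<^sup>2) * sech_coeff q (n - k)))"
  have "(\<lambda>(n, k). F n k) summable_on UNIV \<times> UNIV"
  proof (rule summable_on_prod_bound)
    show "(\<lambda>n. norm (sech_coeff q n) * B) summable_on UNIV"
      by (intro summable_on_cmult_left summable_norm_sech assms)
    show "norm (case (n, k) of (n, k) \<Rightarrow> F n k) \<le> norm (sech_coeff q n) * B * norm (q powi k\<^sup>2)" for n k
    proof -
      have "norm (F n k) = norm (sech_coeff q n) * norm (q powi k\<^sup>2) * norm (sech_coeff q (n - k))"
        by (simp add: F_def norm_mult)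
      also have "\<dots> \<le> norm (sech_coeff q n) * norm (q powi k\<^sup>2) * B"
        by (intro mult_left_mono B) auto
      finally show ?thesis by (simp add: mult_ac)
    qed
  qed (use B summable_norm_theta[OF assms] in auto)
  then have swap: "(\<Sum>\<^sub>\<infinity>n. \<Sum>\<^sub>\<infinity>k. F n k) = (\<Sum>\<^sub>\<infinity>k. \<Sum>\<^sub>\<infinity>n. F n k)"
    by (rule infsum_swap_banach)
  have g0: "(\<Sum>\<^sub>\<infinity>n. (-1) powi n * q powi (n\<^sup>2) * sech_coeff q n) = theta_sech q 0"
    by (simp add: theta_sech_def sech_coeff_minus[OF assms])
  have "(\<Sum>\<^sub>\<infinity>k. F n k) = (-1) powi n * q powi (n\<^sup>2) * sech_coeff q n * theta_sech q 0" for n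
    using theta_sech_eq[OF assms, of n]
    by (simp add: F_def infsum_cmult_right' theta_sech_def[symmetric])
  then have L: "(\<Sum>\<^sub>\<infinity>n. \<Sum>\<^sub>\<infinity>k. F n k) = (theta_sech q 0)\<^sup>2"
    by (simp only: infsum_cmult_left' g0 power2_eq_square[of "theta_sech q 0"])
  have "(\<Sum>\<^sub>\<infinity>n. F n k) = (if k = 0 then \<Sum>\<^sub>\<infinity>n. (-1) powi n * (sech_coeff q n)\<^sup>2 else 0)" for k
  proof (cases "k = 0")
    case True
    then show ?thesis by (simp add: F_def power2_eq_square mult.assoc)
  next
    case False
    define c where "c = q powi k / (1 - q powi (2 * k))"
    have "F n k = (-1) powi k * q powi (k\<^sup>2) * c * ((-1) powi n * (fermi q (n - k) - fermi q n))" for n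
    proof -
      have "F n k = (-1) powi k * q powi (k\<^sup>2) * (-1) powi n * (sech_coeff q n * sech_coeff q (n - k))"
        by (simp add: F_def mult_ac)
      then show ?thesis
        unfolding sech_mult_shift[OF assms False] c_def by (simp add: mult_ac)
    qed
    then have "(\<Sum>\<^sub>\<infinity>n. F n k) = (-1) powi k * q powi (k\<^sup>2) * c * (\<Sum>\<^sub>\<infinity>n. (-1) powi n * (fermi q (n - k) - fermi q n))"
      by (simp only: infsum_cmult_right')
    then show ?thesis using False by (simp only: infsum_fermi_diff[OF assms]) simp
  qed
  then have "(\<Sum>\<^sub>\<infinity>k. \<Sum>\<^sub>\<infinity>n. F n k)
      = (\<Sum>\<^sub>\<infinity>k::int. if k = 0 then \<Sum>\<^sub>\<infinity>n. (-1) powi n * (sech_coeff q n)\<^sup>2 else 0)"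
    by (simp only:)
  also have "\<dots> = (\<Sum>\<^sub>\<infinity>k\<in>{0::int}. \<Sum>\<^sub>\<infinity>n. (-1) powi n * (sech_coeff q n)\<^sup>2)"
    by (rule infsum_cong_neutral) auto
  finally show ?thesis using L swap by simp
qed

section \<open>The two squares theorem\<close>

text \<open>Adding the values at q and -q keeps the even j, and v_(2j) at q is v_j at q^2.\<close>

lemma sech_sum_dissect:
  assumes "nome q"
  shows "sech_sum q + sech_sum (- q) = 2 * sech_sum (q\<^sup>2)"
proof -
  have "(\<lambda>j. (-1) powi j * sech_coeff q j) summable_on UNIV"
    using summable_sech[OF nome_uminus[OF assms]] by (simp add: sech_coeff_uminus)
  then have "sech_sum q + sech_sum (- q) = (\<Sum>\<^sub>\<infinity>j. sech_coeff q j + (-1) powi j * sech_coeff q j)"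
    unfolding sech_sum_uminus by (subst infsum_add[OF summable_sech[OF assms]]) (auto simp: sech_sum_def)
  also have "\<dots> = (\<Sum>\<^sub>\<infinity>j. if even j then 2 * sech_coeff q j else 0)"
    by (rule infsum_cong) auto
  also have "\<dots> = (\<Sum>\<^sub>\<infinity>j. 2 * sech_coeff q (2 * j))"
    by (rule infsum_int_even)
  also have "\<dots> = (\<Sum>\<^sub>\<infinity>j. 2 * sech_coeff (q\<^sup>2) j)"
    by (simp add: sech_coeff_def power_int_power)
  finally show ?thesis by (simp add: sech_sum_def infsum_cmult_right')
qed

section \<open>Rotating the square lattice in products of two theta series\<close>

lemma theta_mult:
  assumes "nome p" "nome q"
  shows "(\<lambda>(a, b). p powi (a\<^sup>2) * q powi (b\<^sup>2)) summable_on UNIV \<times> UNIV"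
    and "(\<Sum>\<^sub>\<infinity>(a, b)\<in>UNIV \<times> UNIV. p powi (a\<^sup>2) * q powi (b\<^sup>2)) = theta p * theta q"
  unfolding theta_def by (intro infsum_mult_prod summable_norm_theta assms)+

lemma infsum_same_parity:
  fixes f :: "int \<Rightarrow> int \<Rightarrow> 'a :: {comm_monoid_add, t2_space}"
  shows "(\<Sum>\<^sub>\<infinity>(a, b)\<in>{(a, b). even (a + b)}. f a b) = (\<Sum>\<^sub>\<infinity>(u, v)\<in>UNIV \<times> UNIV. f (u + v) (u - v))"
proof -
  have half: "(a + b) div 2 + (a - b) div 2 = a \<and> (a + b) div 2 - (a - b) div 2 = b"
    if "even (a + b)" for a b :: int
    using that by presburger
  show ?thesis
    by (rule infsum_reindex_bij_witness[of _ "\<lambda>(u, v). (u + v, u - v)" "\<lambda>(a, b). ((a + b) div 2, (a - b) div 2)"])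
       (use half in auto)
qed

text \<open>The two double series differ by the sign (-1)^(a+b), so pairs of equal parity survive,
  doubled. The rotation a = u + v, b = u - v turns a^2 + b^2 into 2u^2 + 2v^2.\<close>

lemma theta_sum_square:
  assumes "nome q"
  shows "(theta q)\<^sup>2 + (theta (- q))\<^sup>2 = 2 * (theta (q\<^sup>2))\<^sup>2"
proof -
  note q2 = nome_power[OF assms, of 2, simplified]
  have "(theta q)\<^sup>2 + (theta (- q))\<^sup>2 =
    (\<Sum>\<^sub>\<infinity>(a, b)\<in>UNIV \<times> UNIV. q powi (a\<^sup>2) * q powi (b\<^sup>2)) +
    (\<Sum>\<^sub>\<infinity>(a, b)\<in>UNIV \<times> UNIV. (- q) powi (a\<^sup>2) * (- q) powi (b\<^sup>2))"
    using theta_mult(2)[OF assms assms] theta_mult(2)[OF nome_uminus[OF assms] nome_uminus[OF assms]]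
    by (simp add: power2_eq_square)
  also have "\<dots> = (\<Sum>\<^sub>\<infinity>x\<in>UNIV \<times> UNIV. (case x of (a, b) \<Rightarrow> q powi (a\<^sup>2) * q powi (b\<^sup>2)) +
      (case x of (a, b) \<Rightarrow> (- q) powi (a\<^sup>2) * (- q) powi (b\<^sup>2)))"
    by (intro infsum_add[symmetric] theta_mult nome_uminus assms)
  also have "\<dots> = (\<Sum>\<^sub>\<infinity>(a, b)\<in>{(a, b). even (a + b)}. 2 * (q powi (a\<^sup>2) * q powi (b\<^sup>2)))"
  proof (rule infsum_cong_neutral)
    fix p :: "int \<times> int"
    assume "p \<in> UNIV \<times> UNIV - {(a, b). even (a + b)}"
    then show "(case p of (a, b) \<Rightarrow> q powi (a\<^sup>2) * q powi (b\<^sup>2)) +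
      (case p of (a, b) \<Rightarrow> (- q) powi (a\<^sup>2) * (- q) powi (b\<^sup>2)) = 0"
      by (cases p; cases "even (fst p)") (auto simp: powi_uminus[of q] minus_one_powi_sq)
  next
    fix p :: "int \<times> int"
    assume "p \<in> UNIV \<times> UNIV \<inter> {(a, b). even (a + b)}"
    then show "(case p of (a, b) \<Rightarrow> q powi (a\<^sup>2) * q powi (b\<^sup>2)) +
      (case p of (a, b) \<Rightarrow> (- q) powi (a\<^sup>2) * (- q) powi (b\<^sup>2)) =
      (case p of (a, b) \<Rightarrow> 2 * (q powi (a\<^sup>2) * q powi (b\<^sup>2)))"
      by (cases p; cases "even (fst p)") (auto simp: powi_uminus[of q] minus_one_powi_sq)
  qed auto
  also have "\<dots> = (\<Sum>\<^sub>\<infinity>(u, v)\<in>UNIV \<times> UNIV. 2 * (q powi ((u + v)\<^sup>2) * q powi ((u - v)\<^sup>2)))"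
    by (rule infsum_same_parity)
  also have "\<dots> = (\<Sum>\<^sub>\<infinity>x\<in>UNIV \<times> UNIV. 2 * (case x of (u, v) \<Rightarrow> (q\<^sup>2) powi (u\<^sup>2) * (q\<^sup>2) powi (v\<^sup>2)))"
  proof (rule infsum_cong, clarify)
    fix u v :: int
    have "(u + v)\<^sup>2 + (u - v)\<^sup>2 = 2 * u\<^sup>2 + 2 * v\<^sup>2" by (simp add: power2_eq_square algebra_simps)
    then show "2 * (q powi ((u + v)\<^sup>2) * q powi ((u - v)\<^sup>2)) = 2 * ((q\<^sup>2) powi (u\<^sup>2) * (q\<^sup>2) powi (v\<^sup>2))"
      using assms by (simp add: nome_def power_int_power flip: power_int_add)
  qed
  also have "\<dots> = 2 * (theta (q\<^sup>2))\<^sup>2"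
    by (simp only: infsum_cmult_right' theta_mult[OF q2 q2] power2_eq_square[of "theta (q\<^sup>2)"])
  finally show ?thesis .
qed

lemma theta_mult_uminus:
  assumes "nome q"
  shows "theta q * theta (- q) = (theta (- (q\<^sup>2)))\<^sup>2"
proof -
  note q2 = nome_uminus[OF nome_power[OF assms, of 2, simplified]]
  let ?f = "\<lambda>(a, b). q powi (a\<^sup>2) * (- q) powi (b\<^sup>2)"
  let ?E = "{(a :: int, b :: int). even (a + b)}"
  have S: "?f summable_on A" for A
    using theta_mult(1)[OF assms nome_uminus[OF assms]] by (rule summable_on_subset_banach) auto
  \<comment> \<open>When a and b have opposite parity, exchanging them flips the sign (-1)^b, so
    this part equals its own negative.\<close>
  have "infsum ?f (- ?E) = (\<Sum>\<^sub>\<infinity>p\<in>- ?E. - ?f p)"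
  proof (rule infsum_reindex_bij_witness[of _ prod.swap prod.swap])
    fix p assume "p \<in> - ?E"
    then show "- ?f (prod.swap p) = ?f p"
      by (cases p; cases "even (fst p)") (auto simp: powi_uminus[of q] minus_one_powi_sq)
  qed (auto simp: add.commute)
  then have odd0: "infsum ?f (- ?E) = 0"
    by (simp add: infsum_uminus)
  have "theta q * theta (- q) = infsum ?f (?E \<union> - ?E)"
    using theta_mult(2)[OF assms nome_uminus[OF assms]] by simp
  also have "\<dots> = infsum ?f ?E"
    using S odd0 by (subst infsum_Un_disjoint) auto
  also have "\<dots> = (\<Sum>\<^sub>\<infinity>(u, v)\<in>UNIV \<times> UNIV. q powi ((u + v)\<^sup>2) * (- q) powi ((u - v)\<^sup>2))"
    by (rule infsum_same_parity)
  also have "\<dots> = (\<Sum>\<^sub>\<infinity>(u, v)\<in>UNIV \<times> UNIV. (- (q\<^sup>2)) powi (u\<^sup>2) * (- (q\<^sup>2)) powi (v\<^sup>2))"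
  proof (rule infsum_cong, clarify)
    fix u v :: int
    have "(u + v)\<^sup>2 + (u - v)\<^sup>2 = 2 * u\<^sup>2 + 2 * v\<^sup>2" by (simp add: power2_eq_square algebra_simps)
    then have "q powi ((u + v)\<^sup>2) * q powi ((u - v)\<^sup>2) = (q\<^sup>2) powi (u\<^sup>2) * (q\<^sup>2) powi (v\<^sup>2)"
      using assms by (simp add: nome_def power_int_power flip: power_int_add)
    then show "q powi ((u + v)\<^sup>2) * (- q) powi ((u - v)\<^sup>2) = (- (q\<^sup>2)) powi (u\<^sup>2) * (- (q\<^sup>2)) powi (v\<^sup>2)"
      unfolding powi_uminus[of q] powi_uminus[of "q\<^sup>2"] minus_one_powi_sq minus_one_powi_diff
      by (simp add: mult_ac)
  qed
  also have "\<dots> = (theta (- (q\<^sup>2)))\<^sup>2"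
    by (simp only: theta_mult[OF q2 q2] power2_eq_square[of "theta (- (q\<^sup>2))"])
  finally show ?thesis .
qed

section \<open>Estimates as the nome tends to 0\<close>

lemma norm_infsum_geometric_le:
  fixes f :: "nat \<Rightarrow> complex"
  assumes "0 \<le> r" "r < 1" "f summable_on {1..}" "\<And>n. n \<ge> 1 \<Longrightarrow> norm (f n) \<le> r ^ n * c"
  shows "norm (infsum f {1..}) \<le> r / (1 - r) * c"
proof (rule norm_infsum_le)
  show "(f has_sum infsum f {1..}) {1..}" using assms(3) by simp
  show "((\<lambda>n. r ^ n * c) has_sum (r / (1 - r) * c)) {1..}"
    using assms by (intro has_sum_cmult_left has_sum_geometric_from_1) auto
qed (use assms(4) in auto)

lemma norm_theta_minus_one:
  assumes "nome q"
  shows "norm (theta q - 1) \<le> 2 * (norm q / (1 - norm q))"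
proof -
  have q: "norm q < 1" using assms by (simp add: nome_def)
  have "norm (\<Sum>\<^sub>\<infinity>n\<in>{1..}. q ^ (n\<^sup>2)) \<le> norm q / (1 - norm q) * 1"
  proof (rule norm_infsum_geometric_le[OF _ q theta_nat(2)[OF assms]])
    fix n :: nat assume "n \<ge> 1"
    then have "n \<le> n\<^sup>2" by (simp add: power2_eq_square)
    then show "norm (q ^ n\<^sup>2) \<le> norm q ^ n * 1"
      using q by (simp add: norm_power power_decreasing)
  qed simp
  then show ?thesis
    by (simp add: theta_nat(1)[OF assms] norm_mult)
qed

text \<open>The 1 is twice the central term v_0 = 1/2; the other terms pair up by evenness and
  vanish with q.\<close>

lemma norm_sech_sum_minus:
  assumes "nome q"
  shows "norm (2 * sech_sum q - 1) \<le> 4 * (norm q / (1 - norm q) * (1 / (1 - (norm q)\<^sup>2)))"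
proof -
  have q: "norm q < 1" using assms by (simp add: nome_def)
  note sp = infsum_int_split[OF summable_sech[OF assms], unfolded sech_coeff_minus[OF assms]]
  have e: "sech_coeff q (int n) + sech_coeff q (int n) = 2 * sech_coeff q (int n)" for n by simp
  have s: "(\<lambda>n. sech_coeff q (int n)) summable_on {1..}"
    using sp(2) by (simp add: e summable_on_cmult_right')
  have "2 * sech_sum q - 1 = 4 * (\<Sum>\<^sub>\<infinity>n::nat\<in>{1..}. sech_coeff q (int n))"
    unfolding sech_sum_def sp(1) e by (simp add: infsum_cmult_right' sech_coeff_def[of _ 0])
  moreover have "norm (\<Sum>\<^sub>\<infinity>n::nat\<in>{1..}. sech_coeff q (int n)) \<le> norm q / (1 - norm q) * (1 / (1 - (norm q)\<^sup>2))"
  proof (rule norm_infsum_geometric_le[OF _ q s])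
    show "norm (sech_coeff q (int n)) \<le> norm q ^ n * (1 / (1 - (norm q)\<^sup>2))" for n
      using norm_sech_coeff_le[OF assms, of "int n"] by simp
  qed simp
  ultimately show ?thesis by (simp add: norm_mult)
qed

text \<open>The ratio of both sides is invariant under \<open>q \<mapsto> q\<^sup>2\<close> and tends to 1 at 0.\<close>
lemma two_squares:
  assumes "nome q"
  shows "2 * sech_sum q = (theta q)\<^sup>2"
proof -
  define R where "R = (\<lambda>q. 2 * sech_sum q / (theta q)\<^sup>2)"
  have step: "R (q\<^sup>2) = R q" if q: "nome q" for q
  proof -
    have nz: "theta q \<noteq> 0" "theta (- q) \<noteq> 0" "theta (q\<^sup>2) \<noteq> 0"
      using theta_nonzero q nome_uminus nome_power[of q 2] by auto
    \<comment> \<open>By evenness of \<open>theta_sech\<close> at 0, the same factor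
      \<open>g\<close> (not the \<open>g\<close> of the overview, but its quotient by two theta
      values) relates \<open>sech_sum\<close> to the squared theta at q and at -q. It then passes
      through both dissections to q^2.\<close>
    define g where "g = theta_sech q 0 / (theta q * theta (- q))"
    have "sech_sum (- q) = g * (theta (- q))\<^sup>2"
      using theta_sech_sum[OF q] nz by (simp add: g_def power2_eq_square field_simps)
    moreover have g: "sech_sum q = g * (theta q)\<^sup>2"
      using theta_sech_sum[OF nome_uminus[OF q]] nz
      by (simp add: g_def power2_eq_square field_simps theta_sech_0_uminus[OF q])
    ultimately have "2 * sech_sum (q\<^sup>2) = g * ((theta q)\<^sup>2 + (theta (- q))\<^sup>2)"
      unfolding sech_sum_dissect[OF q, symmetric] by (simp add: algebra_simps)
    then have "sech_sum (q\<^sup>2) = g * (theta (q\<^sup>2))\<^sup>2"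
      unfolding theta_sum_square[OF q] by simp
    then show ?thesis using g nz by (simp add: R_def)
  qed
  \<comment> \<open>Invariance is needed only along the iterated squares of q, whose norms tend to
    0.\<close>
  define Q where "Q = (\<lambda>n. q ^ (2 ^ n))"
  have Q: "nome (Q n)" for n using assms by (auto simp: Q_def intro: nome_power)
  have RQ: "R (Q n) = R q" for n
  proof (induction n)
    case (Suc n)
    have "Q (Suc n) = (Q n)\<^sup>2" by (simp add: Q_def power_mult mult.commute flip: power_mult)
    then show ?case using step[OF Q[of n]] Suc by simp
  qed (simp add: Q_def)
  have "(\<lambda>n. norm q ^ (2 ^ n)) \<longlonglongrightarrow> 0"
    using LIMSEQ_subseq_LIMSEQ[OF LIMSEQ_realpow_zero, of "norm q" "\<lambda>n. 2 ^ n"] assms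
    by (simp add: nome_def strict_mono_def o_def)
  then have lim: "(\<lambda>n. norm (Q n)) \<longlonglongrightarrow> 0" by (simp add: Q_def norm_power)
  have "(\<lambda>n. 2 * (norm (Q n) / (1 - norm (Q n)))) \<longlonglongrightarrow> 2 * (0 / (1 - 0))"
    by (intro tendsto_intros lim) auto
  then have bound: "(\<lambda>n. 2 * (norm (Q n) / (1 - norm (Q n)))) \<longlonglongrightarrow> 0" by simp
  have "(\<lambda>n. theta (Q n) - 1) \<longlonglongrightarrow> 0"
    by (rule Lim_null_comparison[OF always_eventually[OF allI] bound])
       (rule norm_theta_minus_one[OF Q])
  then have t: "(\<lambda>n. theta (Q n)) \<longlonglongrightarrow> 1" by (simp add: LIM_zero_iff)
  have "(\<lambda>n. 4 * (norm (Q n) / (1 - norm (Q n)) * (1 / (1 - (norm (Q n))\<^sup>2))))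
      \<longlonglongrightarrow> 4 * (0 / (1 - 0) * (1 / (1 - 0\<^sup>2)))"
    by (intro tendsto_intros lim) auto
  then have bound: "(\<lambda>n. 4 * (norm (Q n) / (1 - norm (Q n)) * (1 / (1 - (norm (Q n))\<^sup>2)))) \<longlonglongrightarrow> 0"
    by simp
  have "(\<lambda>n. 2 * sech_sum (Q n) - 1) \<longlonglongrightarrow> 0"
    by (rule Lim_null_comparison[OF always_eventually[OF allI] bound])
       (rule norm_sech_sum_minus[OF Q])
  then have "(\<lambda>n. 2 * sech_sum (Q n)) \<longlonglongrightarrow> 1" by (simp add: LIM_zero_iff)
  from tendsto_divide[OF this tendsto_power[OF t, of 2]] have "(\<lambda>n. R (Q n)) \<longlonglongrightarrow> 1"
    by (simp add: R_def)
  then have "R q = 1" unfolding RQ by (simp add: LIMSEQ_const_iff)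
  then show ?thesis using theta_nonzero[OF assms] by (simp add: R_def)
qed

text \<open>\<open>two_squares\<close> at -q replaces \<open>sech_sum\<close> by a squared theta, of
  which one factor cancels.\<close>

lemma theta_sech_0:
  assumes "nome q"
  shows "2 * theta_sech q 0 = (theta (- (q\<^sup>2)))\<^sup>2"
proof -
  have "theta (- q) * theta_sech q 0 = theta q * sech_sum (- q)"
    by (rule theta_sech_sum[OF assms])
  then have "theta (- q) * (2 * theta_sech q 0) = theta q * (theta (- q))\<^sup>2"
    by (simp flip: two_squares[OF nome_uminus[OF assms]])
  then have "2 * theta_sech q 0 = theta q * theta (- q)"
    using theta_nonzero[OF nome_uminus[OF assms]] by (simp add: power2_eq_square)
  then show ?thesis by (simp add: theta_mult_uminus[OF assms])
qed

section \<open>The Hecke-type sum\<close>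

lemma powi_add: "(q :: complex) \<noteq> 0 \<Longrightarrow> q powi (a + b) = q powi a * q powi b"
  by (simp add: power_int_add)

lemma fermi_eq_sech: "nome q \<Longrightarrow> fermi q j = q powi j * sech_coeff q j"
  by (simp add: fermi_def sech_coeff_def powi_double power2_eq_square)

text \<open>The relation 1 - tanh^2 = sech^2 in the form y (1 - y) = v^2. It handles the case k = 0,
  excluded from \<open>fermi_addition\<close>, and is how the squares v_m^2 enter.\<close>

lemma fermi_mult_complement:
  assumes "nome q"
  shows "fermi q j * (1 - 2 * fermi q j) = 2 * (sech_coeff q j)\<^sup>2 - fermi q j"
proof -
  define x where "x = q powi j"
  have nz: "1 + x\<^sup>2 \<noteq> 0"
    using one_plus_powi_nonzero[OF assms, of j] unfolding powi_double x_def .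
  have f: "fermi q j = x\<^sup>2 / (1 + x\<^sup>2)" and s: "sech_coeff q j = x / (1 + x\<^sup>2)"
    by (simp_all add: fermi_def sech_coeff_def powi_double x_def)
  have "1 - fermi q j = 1 / (1 + x\<^sup>2)"
    unfolding f using nz by (simp add: field_simps)
  then have "fermi q j * (1 - fermi q j) = (sech_coeff q j)\<^sup>2"
    by (simp add: f s power2_eq_square)
  then show ?thesis by algebra
qed

text \<open>For negative j the bound grows although \<open>fermi\<close> stays bounded. Its gain is
  multiplicativity: at j = m - k it splits into |q|^(2m), summable over m, and |q|^(-2k), absorbed
  by q^(k^2).\<close>

lemma norm_fermi_le:
  assumes "nome q"
  shows "norm (fermi q j) \<le> norm q powi (2 * j) / (1 - (norm q)\<^sup>2)"
proof -
  have q: "0 < norm q" "norm q < 1" using assms by (auto simp: nome_def)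
  have "norm q ^ nat \<bar>j\<bar> = norm q powi \<bar>j\<bar>" by (simp add: power_int_nonneg_exp)
  also have "\<dots> \<le> norm q powi j" using q by (intro power_int_decreasing) auto
  finally have le: "norm q ^ nat \<bar>j\<bar> \<le> norm q powi j" .
  have "norm q powi j * norm q ^ nat \<bar>j\<bar> \<le> norm q powi j * norm q powi j"
    using q by (intro mult_left_mono[OF le]) simp
  also have "\<dots> = norm q powi (2 * j)" using q unfolding mult_2 by (intro power_int_add[symmetric]) auto
  finally have "norm q powi j * norm q ^ nat \<bar>j\<bar> / (1 - (norm q)\<^sup>2) \<le> norm q powi (2 * j) / (1 - (norm q)\<^sup>2)"
    using nome_sq_less[OF assms] by (intro divide_right_mono) auto
  moreover have "norm (fermi q j) \<le> norm q powi j * (norm q ^ nat \<bar>j\<bar> / (1 - (norm q)\<^sup>2))"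
    unfolding fermi_eq_sech[OF assms] norm_mult norm_power_int
    using q by (intro mult_left_mono norm_sech_coeff_le assms) auto
  ultimately show ?thesis by simp
qed

section \<open>One-sided alternating sums and the addition theorem\<close>

lemma summable_even_powers:
  fixes r :: real
  assumes "0 < r" "r < 1"
  shows "(\<lambda>m. r powi (2 * int m)) summable_on {1..}"
proof -
  have "(\<lambda>m. (r\<^sup>2) ^ m) summable_on {1::nat..}"
    using has_sum_geometric_from_1[of "r\<^sup>2"] assms
    by (auto simp: abs_square_less_1 intro!: has_sum_imp_summable)
  moreover have "r powi (2 * int m) = (r\<^sup>2) ^ m" for m
    by (metis of_nat_mult of_nat_numeral power_int_of_nat power_mult)
  ultimately show ?thesis by simp
qed

lemma summable_norm_fermi_shift:
  assumes "nome q"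
  shows "(\<lambda>m. norm (fermi q (int m + j))) summable_on {1..}"
proof (rule Infinite_Sum.abs_summable_on_comparison_test')
  have q: "0 < norm q" "norm q < 1" using assms by (auto simp: nome_def)
  show "(\<lambda>m. norm q powi (2 * int m) * (norm q powi (2 * j) / (1 - (norm q)\<^sup>2))) summable_on {1..}"
    by (intro summable_on_cmult_left summable_even_powers q)
  show "norm (fermi q (int m + j)) \<le> norm q powi (2 * int m) * (norm q powi (2 * j) / (1 - (norm q)\<^sup>2))" for m
    using norm_fermi_le[OF assms, of "int m + j"] q by (simp add: power_int_add distrib_left)
qed

lemma summable_alt_fermi_shift:
  assumes "nome q"
  shows "(\<lambda>m. (-1) ^ m * fermi q (int m + j)) summable_on {1..}"
proof -
  have "(\<lambda>m. norm ((-1) ^ m * fermi q (int m + j))) summable_on {1..}"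
    using summable_norm_fermi_shift[OF assms, of j] by (simp add: norm_mult norm_power)
  then show ?thesis by (rule abs_summable_summable)
qed

text \<open>One-sided because \<open>fermi\<close> does not decay at minus infinity. At j = 0 it is,
  up to sign, the first double sum of the theorem.\<close>

definition fermi_sum :: "complex \<Rightarrow> int \<Rightarrow> complex" where
  "fermi_sum q j = (\<Sum>\<^sub>\<infinity>m\<in>{1..}. (-1) ^ m * fermi q (int m + j))"

lemma fermi_sum_Suc:
  assumes "nome q"
  shows "fermi_sum q (j + 1) + fermi_sum q j = - fermi q (j + 1)"
proof -
  let ?f = "\<lambda>m. (-1) ^ m * fermi q (int m + j)"
  have "fermi_sum q (j + 1) = (\<Sum>\<^sub>\<infinity>m\<in>{2..}. - ?f m)"
    unfolding fermi_sum_def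
    by (rule infsum_reindex_bij_witness[of _ "\<lambda>m. m - 1" Suc]) (auto simp: algebra_simps)
  then have A: "fermi_sum q (j + 1) = - infsum ?f {2..}"
    by (simp add: infsum_uminus)
  have "{1::nat..} = insert 1 {2..}" by auto
  moreover have "?f summable_on {2..}"
    using summable_alt_fermi_shift[OF assms, of j] by (rule summable_on_subset_banach) auto
  ultimately have "fermi_sum q j = ?f 1 + infsum ?f {2..}"
    unfolding fermi_sum_def by (simp add: infsum_insert)
  with A show ?thesis by (simp add: add.commute)
qed

text \<open>For k > 0 the difference is (-1)^k times the finite alternating sum of y_i over -k < i
  \<le> k. Pairing i with -i by y_(-i) = 1 - y_i leaves only y_k and a constant. The induction
  tracks the defect \<open>P\<close>, which changes sign at each step and vanishes at 0 since y_0 =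
  1/2.\<close>

lemma fermi_sum_diff:
  assumes "nome q"
  shows "fermi_sum q (- k) - fermi_sum q k = fermi q k - 1 / 2"
proof -
  define P where "P = (\<lambda>k. fermi_sum q (- k) - fermi_sum q k - fermi q k + 1 / 2)"
  have step: "P (k + 1) = - P k" for k
    using fermi_sum_Suc[OF assms, of k] fermi_sum_Suc[OF assms, of "- k - 1"] fermi_minus[OF assms, of k]
    by (simp add: P_def) algebra
  have "P k = 0"
  proof (induction k rule: int_induct[where k = 0])
    case base
    show ?case by (simp add: P_def fermi_def)
  next
    case (step2 i)
    then show ?case using step[of "i - 1"] by simp
  qed (use step in auto)
  moreover have "fermi_sum q (- k) - fermi_sum q k = P k + fermi q k - 1 / 2"
    by (simp add: P_def)
  ultimately show ?thesis by simp
qed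

text \<open>The addition theorem of tanh, arranged so that m occurs only in single values of
  \<open>fermi\<close>, which \<open>fermi_sum\<close> can add up. The denominator is tanh of the
  shift, hence k \<noteq> 0; it cancels later against \<open>fermi_sum_diff\<close>.\<close>

lemma fermi_addition:
  assumes "nome q" "k \<noteq> 0"
  shows "(fermi q (m - k) + fermi q (m + k)) * (1 - 2 * fermi q m)
     = - 2 * fermi q m + (fermi q (m - k) - fermi q (m + k)) / (1 - 2 * fermi q k)"
proof -
  define x where "x = q powi (2 * m)"
  define y where "y = q powi (2 * k)"
  have q: "q \<noteq> 0" using assms by (simp add: nome_def)
  then have y0: "y \<noteq> 0" by (simp add: y_def)
  have xp: "q powi (2 * (m + k)) = x * y" using q by (simp add: x_def y_def power_int_add distrib_left)
  have xm: "q powi (2 * (m - k)) = x / y" using q by (simp add: x_def y_def power_int_diff right_diff_distrib)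
  have nz: "1 + x \<noteq> 0" "1 + y \<noteq> 0" "1 - y \<noteq> 0" "1 + x * y \<noteq> 0" "1 + x / y \<noteq> 0"
    using one_plus_powi_nonzero[OF assms(1), of m] one_plus_powi_nonzero[OF assms(1), of k]
      one_minus_powi_nonzero[OF assms] one_plus_powi_nonzero[OF assms(1), of "m + k"]
      one_plus_powi_nonzero[OF assms(1), of "m - k"]
    unfolding xp xm unfolding x_def y_def by this+
  have nz': "y + x \<noteq> 0" using y0 nz(5) by (metis add_divide_distrib divide_self_if div_0)
  have ym: "fermi q (m - k) = x / (y + x)"
    unfolding fermi_def xm using y0 nz nz' by (simp add: divide_simps)
  have yp: "fermi q (m + k) = x * y / (1 + x * y)" unfolding fermi_def xp ..
  have wm: "1 - 2 * fermi q m = (1 - x) / (1 + x)"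
    using nz unfolding fermi_def x_def[symmetric] by (simp add: field_simps)
  have wk: "1 - 2 * fermi q k = (1 - y) / (1 + y)"
    using nz unfolding fermi_def y_def[symmetric] by (simp add: field_simps)
  have fm: "fermi q m = x / (1 + x)" by (simp add: fermi_def x_def)
  have "x / (y + x) - x * y / (1 + x * y) = x * (1 - y) * (1 + y) / ((y + x) * (1 + x * y))"
    unfolding diff_frac_eq[OF nz' nz(4)] by (rule arg_cong2[where f = divide]) (algebra | rule refl)+
  then have d: "(fermi q (m - k) - fermi q (m + k)) / (1 - 2 * fermi q k) = x * (1 + y)\<^sup>2 / ((y + x) * (1 + x * y))"
    unfolding ym yp wk using nz nz' by (simp add: power2_eq_square)
  have "x / (y + x) + x * y / (1 + x * y) = x * (1 + 2 * x * y + y\<^sup>2) / ((y + x) * (1 + x * y))"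
    unfolding add_frac_eq[OF nz' nz(4)] by (rule arg_cong2[where f = divide]) (algebra | rule refl)+
  then have "(fermi q (m - k) + fermi q (m + k)) * (1 - 2 * fermi q m)
     = x * (1 + 2 * x * y + y\<^sup>2) * (1 - x) / (((y + x) * (1 + x * y)) * (1 + x))"
    unfolding ym yp wm by simp
  also have "x * (1 + 2 * x * y + y\<^sup>2) * (1 - x)
      = (x * (1 + y)\<^sup>2) * (1 + x) - (2 * x) * ((y + x) * (1 + x * y))"
    by algebra
  also have "\<dots> / (((y + x) * (1 + x * y)) * (1 + x))
     = x * (1 + y)\<^sup>2 / ((y + x) * (1 + x * y)) - 2 * x / (1 + x)"
    using nz nz' by (subst diff_frac_eq) auto
  finally show ?thesis unfolding d fm by simp
qed

definition theta_fermi :: "complex \<Rightarrow> int \<Rightarrow> complex" where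
  "theta_fermi q n = (\<Sum>\<^sub>\<infinity>k. q powi (k\<^sup>2) * fermi q (n - k))"

lemma summable_theta_fermi:
  assumes "nome q"
  shows "(\<lambda>k. q powi (k\<^sup>2) * fermi q (n - k)) summable_on UNIV"
proof -
  have q: "0 < norm q" using assms by (simp add: nome_def)
  define c where "c = norm q powi (2 * n) / (1 - (norm q)\<^sup>2)"
  have "(\<lambda>k. norm (q powi (k\<^sup>2) * fermi q (n - k))) summable_on UNIV"
  proof (rule Infinite_Sum.abs_summable_on_comparison_test')
    show "(\<lambda>k. norm (q powi (k\<^sup>2 + (-2) * k)) * c) summable_on UNIV"
      by (intro summable_on_cmult_left summable_norm_quadratic assms)
    show "norm (q powi (k\<^sup>2) * fermi q (n - k)) \<le> norm (q powi (k\<^sup>2 + (-2) * k)) * c" for k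
    proof -
      have "norm (q powi (k\<^sup>2) * fermi q (n - k)) \<le> norm q powi (k\<^sup>2) * (norm q powi (2 * (n - k)) / (1 - (norm q)\<^sup>2))"
        unfolding norm_mult norm_power_int using q by (intro mult_left_mono norm_fermi_le assms) auto
      also have "norm q powi (k\<^sup>2) * (norm q powi (2 * (n - k)) / (1 - (norm q)\<^sup>2))
          = norm q powi (k\<^sup>2 + 2 * (n - k)) / (1 - (norm q)\<^sup>2)"
        using q by (subst power_int_add) auto
      also have "k\<^sup>2 + 2 * (n - k) = (k\<^sup>2 + (-2) * k) + 2 * n" by simp
      also have "norm q powi ((k\<^sup>2 + (-2) * k) + 2 * n) / (1 - (norm q)\<^sup>2) = norm (q powi (k\<^sup>2 + (-2) * k)) * c"
        unfolding norm_power_int c_def using q by (subst power_int_add) auto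
      finally show ?thesis .
    qed
  qed
  then show ?thesis by (rule abs_summable_summable)
qed

text \<open>Reflection averages y_k and y_(-k) = 1 - y_k to 1/2.\<close>

lemma theta_fermi_0:
  assumes "nome q"
  shows "2 * theta_fermi q 0 = theta q"
proof -
  have s: "(\<lambda>k. q powi (k\<^sup>2) * fermi q (- k)) summable_on UNIV"
    using summable_theta_fermi[OF assms, of 0] by simp
  have "theta_fermi q 0 = (\<Sum>\<^sub>\<infinity>k. q powi ((0 - k)\<^sup>2) * fermi q (0 - (0 - k)))"
    unfolding theta_fermi_def by (rule infsum_int_reflect[symmetric])
  also have "\<dots> = (\<Sum>\<^sub>\<infinity>k. q powi (k\<^sup>2) - q powi (k\<^sup>2) * fermi q (- k))"
    by (simp add: fermi_minus[OF assms] algebra_simps)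
  also have "\<dots> = theta q - (\<Sum>\<^sub>\<infinity>k. q powi (k\<^sup>2) * fermi q (- k))"
    unfolding theta_def diff_conv_add_uminus
    by (subst infsum_add[OF summable_theta[OF assms]]) (auto simp: s infsum_uminus summable_on_uminus)
  finally show ?thesis by (simp add: theta_fermi_def)
qed

text \<open>The mechanism of \<open>theta_sech_Suc\<close> with q^(-2j) y_j = 1 - y_j. Here the
  leftover series is the full theta series instead of zero.\<close>

lemma theta_fermi_Suc:
  assumes "nome q"
  shows "theta_fermi q (n + 1) = q powi (2 * n + 1) * (theta q - theta_fermi q n)"
proof -
  have q: "q \<noteq> 0" using assms by (simp add: nome_def)
  have shifted: "q powi ((k + 1)\<^sup>2) * fermi q (n + 1 - (k + 1))
     = q powi (2 * n + 1) * (q powi (k\<^sup>2) + - (q powi (k\<^sup>2) * fermi q (n - k)))" for k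
  proof -
    have "q powi (- 2 * (n - k)) * fermi q (n - k) = 1 - fermi q (n - k)"
      using fermi_minus[OF assms, of "n - k"] one_plus_powi_nonzero[OF assms, of "n - k"] q
      by (simp add: fermi_def power_int_minus field_simps)
    moreover have "(k + 1)\<^sup>2 = k\<^sup>2 + ((2 * n + 1) + (- 2 * (n - k)))" by (simp add: power2_eq_square algebra_simps)
    then have "q powi ((k + 1)\<^sup>2) = q powi (k\<^sup>2) * (q powi (2 * n + 1) * q powi (- 2 * (n - k)))"
      by (simp only: powi_add[OF q])
    ultimately have "q powi ((k + 1)\<^sup>2) * fermi q (n - k)
       = q powi (k\<^sup>2) * q powi (2 * n + 1) * (1 - fermi q (n - k))"
      by (metis mult.assoc)
    then show ?thesis by (simp add: algebra_simps)
  qed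
  have "theta_fermi q (n + 1) = (\<Sum>\<^sub>\<infinity>k. q powi ((k + 1)\<^sup>2) * fermi q (n + 1 - (k + 1)))"
    unfolding theta_fermi_def by (rule infsum_int_shift[symmetric])
  also have "\<dots> = q powi (2 * n + 1) * (\<Sum>\<^sub>\<infinity>k. q powi (k\<^sup>2) + - (q powi (k\<^sup>2) * fermi q (n - k)))"
    unfolding shifted by (rule infsum_cmult_right')
  also have "(\<Sum>\<^sub>\<infinity>k. q powi (k\<^sup>2) + - (q powi (k\<^sup>2) * fermi q (n - k))) = theta q - theta_fermi q n"
    by (subst infsum_add[OF summable_theta[OF assms]])
       (auto simp: summable_theta_fermi[OF assms] infsum_uminus summable_on_uminus theta_def theta_fermi_def)
  finally show ?thesis .
qed

definition hecke_sum :: "complex \<Rightarrow> nat \<Rightarrow> complex" where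
  "hecke_sum q n = (\<Sum>k\<in>{- int n<..<int n}. (-1) powi k * q powi ((int n)\<^sup>2 - k\<^sup>2))"

text \<open>Enlarging the window adds k = n and k = -n, where the unshifted exponent n^2 - k^2 is 0.
  These are two distinct indices only for n \<ge> 1.\<close>

lemma hecke_sum_Suc:
  assumes "nome q" "n \<ge> 1"
  shows "hecke_sum q (Suc n) = q powi (2 * int n + 1) * (hecke_sum q n + 2 * (-1) ^ n)"
proof -
  have q: "q \<noteq> 0" using assms by (simp add: nome_def)
  define f where "f = (\<lambda>k. (-1) powi k * q powi ((int n)\<^sup>2 - k\<^sup>2))"
  have e: "(int (Suc n))\<^sup>2 - k\<^sup>2 = (2 * int n + 1) + ((int n)\<^sup>2 - k\<^sup>2)" for k
    by (simp add: power2_eq_square algebra_simps)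
  have "hecke_sum q (Suc n) = q powi (2 * int n + 1) * (\<Sum>k\<in>{- int (Suc n)<..<int (Suc n)}. f k)"
    unfolding hecke_sum_def f_def e powi_add[OF q, of "2 * int n + 1"] sum_distrib_left
    by (intro sum.cong refl) (simp only: mult_ac)
  also have "{- int (Suc n)<..<int (Suc n)} = insert (int n) (insert (- int n) {- int n<..<int n})"
    by auto
  also have "(\<Sum>k\<in>\<dots>. f k) = 2 * (-1) ^ n + hecke_sum q n"
    using assms(2) by (simp add: f_def hecke_sum_def power_int_minus_one_minus)
  finally show ?thesis by (simp add: add.commute)
qed

text \<open>The boundary terms of \<open>hecke_sum_Suc\<close> match the inhomogeneous theta term of
  \<open>theta_fermi_Suc\<close>; the starting value n = 1 uses
  \<open>theta_fermi_0\<close>.\<close>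

lemma theta_mult_hecke_sum:
  assumes "nome q" "n \<ge> 1"
  shows "theta q * ((-1) ^ n * hecke_sum q n) = - 2 * theta_fermi q (int n)"
  using assms(2)
proof (induction n rule: dec_induct)
  case base
  have "{- 1<..<1::int} = {0}" by auto
  then have "hecke_sum q 1 = q" by (simp add: hecke_sum_def)
  moreover have "theta_fermi q 1 = q * (theta q - theta_fermi q 0)"
    using theta_fermi_Suc[OF assms(1), of 0] by simp
  then have "2 * theta_fermi q 1 = q * (2 * theta q - 2 * theta_fermi q 0)"
    by algebra
  ultimately show ?case by (simp add: theta_fermi_0[OF assms(1)])
next
  case (step n)
  define u where "u = q powi (2 * int n + 1)"
  have "theta q * ((-1) ^ Suc n * hecke_sum q (Suc n))
      = - u * (theta q * ((-1) ^ n * hecke_sum q n) + 2 * theta q * ((-1) ^ n * (-1) ^ n))"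
    unfolding hecke_sum_Suc[OF assms(1) step(1)] u_def[symmetric] by (simp add: algebra_simps)
  also have "\<dots> = - 2 * (u * (theta q - theta_fermi q (int n)))"
    unfolding step.IH minus_one_mult_self by algebra
  also have "u * (theta q - theta_fermi q (int n)) = theta_fermi q (int (Suc n))"
    unfolding u_def using theta_fermi_Suc[OF assms(1), of "int n"] by (simp add: add.commute)
  finally show ?case .
qed

lemma nat_infsum_sech_square:
  assumes "nome q"
  shows "(\<lambda>m. (-1) ^ m * (sech_coeff q (int m))\<^sup>2) summable_on {1..}"
    and "(theta_sech q 0)\<^sup>2 = 1 / 4 + 2 * (\<Sum>\<^sub>\<infinity>m\<in>{1..}. (-1) ^ m * (sech_coeff q (int m))\<^sup>2)"
proof -
  let ?f = "\<lambda>n. (-1) powi n * (sech_coeff q n)\<^sup>2"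
  have s: "?f summable_on UNIV"
    using summable_sech_mult_shift[OF assms, of 0] by (simp add: power2_eq_square mult.assoc)
  have e: "?f (int m) + ?f (- int m) = 2 * ((-1) ^ m * (sech_coeff q (int m))\<^sup>2)" for m
    by (simp add: sech_coeff_minus[OF assms] power_int_minus_one_minus)
  show "(\<lambda>m. (-1) ^ m * (sech_coeff q (int m))\<^sup>2) summable_on {1..}"
    using infsum_int_split(2)[OF s] unfolding e by (simp add: summable_on_cmult_right')
  show "(theta_sech q 0)\<^sup>2 = 1 / 4 + 2 * (\<Sum>\<^sub>\<infinity>m\<in>{1..}. (-1) ^ m * (sech_coeff q (int m))\<^sup>2)"
    unfolding infsum_sech_square[OF assms, symmetric] infsum_int_split(1)[OF s] e
    by (simp add: infsum_cmult_right' sech_coeff_def[of q 0] power2_eq_square)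
qed

lemma one_minus_fermi_bounded:
  assumes "nome q"
  shows "norm (1 - 2 * fermi q (int m)) \<le> 1 + 2 / (1 - (norm q)\<^sup>2)"
proof -
  have "norm q powi (2 * int m) \<le> 1"
    using assms by (intro power_int_le_one) (auto simp: nome_def)
  then have "norm q powi (2 * int m) / (1 - (norm q)\<^sup>2) \<le> 1 / (1 - (norm q)\<^sup>2)"
    using nome_sq_less[OF assms] by (intro divide_right_mono) auto
  then have "norm (2 * fermi q (int m)) \<le> 2 / (1 - (norm q)\<^sup>2)"
    using norm_fermi_le[OF assms, of "int m"] by (simp add: norm_mult)
  then show ?thesis
    using norm_triangle_ineq4[of 1 "2 * fermi q (int m)"] by simp
qed

lemma summable_fermi_double:
  assumes "nome q"
  shows "(\<lambda>(m, k). (-1) ^ m * (q powi (k\<^sup>2) * fermi q (int m - k)) * (1 - 2 * fermi q (int m)))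
           summable_on {1..} \<times> UNIV"
proof (rule summable_on_prod_bound)
  have q: "0 < norm q" "norm q < 1" using assms by (auto simp: nome_def)
  define c where "c = 1 - (norm q)\<^sup>2"
  have c: "0 < c" using nome_sq_less[OF assms] by (simp add: c_def)
  define B where "B = 1 + 2 / c"
  have B: "0 \<le> B" using c by (simp add: B_def)
  show "(\<lambda>m. norm q powi (2 * int m) * (B / c)) summable_on {1..}"
    by (intro summable_on_cmult_left summable_even_powers q)
  show "(\<lambda>k. norm (q powi (k\<^sup>2 + (-2) * k))) summable_on UNIV"
    by (rule summable_norm_quadratic[OF assms])
  show "0 \<le> norm q powi (2 * int m) * (B / c)" for m
    using B c by simp
  show "norm (case (m, k) of (m, k) \<Rightarrow>
      (-1) ^ m * (q powi (k\<^sup>2) * fermi q (int m - k)) * (1 - 2 * fermi q (int m)))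
      \<le> norm q powi (2 * int m) * (B / c) * norm (q powi (k\<^sup>2 + (-2) * k))" for m k
  proof -
    have f: "norm (fermi q (int m - k)) \<le> norm q powi (2 * (int m - k)) / c"
      unfolding c_def by (rule norm_fermi_le[OF assms])
    have b: "norm (1 - 2 * fermi q (int m)) \<le> B"
      unfolding B_def c_def by (rule one_minus_fermi_bounded[OF assms])
    have "norm q powi (k\<^sup>2) * norm q powi (2 * (int m - k)) = norm q powi (k\<^sup>2 + 2 * (int m - k))"
      using q by (subst power_int_add) auto
    \<comment> \<open>This separates the variables: a geometric factor in m and a quadratic one in
      k.\<close>
    also have "k\<^sup>2 + 2 * (int m - k) = 2 * int m + (k\<^sup>2 + (-2) * k)" by simp
    also have "norm q powi (2 * int m + (k\<^sup>2 + (-2) * k)) = norm q powi (2 * int m) * norm q powi (k\<^sup>2 + (-2) * k)"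
      using q by (subst power_int_add) auto
    finally have e: "norm q powi (k\<^sup>2) * norm q powi (2 * (int m - k))
       = norm q powi (2 * int m) * norm q powi (k\<^sup>2 + (-2) * k)" .
    have "norm ((-1) ^ m * (q powi (k\<^sup>2) * fermi q (int m - k)) * (1 - 2 * fermi q (int m)))
      = norm q powi (k\<^sup>2) * norm (fermi q (int m - k)) * norm (1 - 2 * fermi q (int m))"
      by (simp only: norm_mult norm_power norm_power_int norm_minus_cancel norm_one power_one mult_1_left)
    also have "\<dots> \<le> norm q powi (k\<^sup>2) * (norm q powi (2 * (int m - k)) / c) * B"
      using q B c by (intro mult_mono f b mult_left_mono) auto
    also have "\<dots> = (norm q powi (k\<^sup>2) * norm q powi (2 * (int m - k))) * (B / c)"
      by simp
    finally show ?thesis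
      unfolding e norm_power_int by (simp only: prod.case mult_ac)
  qed
qed auto

text \<open>Summing \<open>fermi_addition\<close> over \<open>m\<close> makes the dependence on \<open>k\<close> disappear.\<close>
lemma fermi_correlation:
  assumes "nome q"
  defines "h \<equiv> \<lambda>k. \<Sum>\<^sub>\<infinity>m\<in>{1..}. (-1) ^ m * fermi q (int m - k) * (1 - 2 * fermi q (int m))"
  shows "k \<noteq> 0 \<Longrightarrow> h k + h (- k) = - 2 * fermi_sum q 0 - 1 / 2"
    and "2 * h 0 = 2 * (theta_sech q 0)\<^sup>2 - 1 / 2 - 2 * fermi_sum q 0"
proof -
  have s: "(\<lambda>m. (-1) ^ m * fermi q (int m - k) * (1 - 2 * fermi q (int m))) summable_on {1..}" for k
  proof -
    have "(\<lambda>m. norm ((-1) ^ m * fermi q (int m - k) * (1 - 2 * fermi q (int m)))) summable_on {1..}"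
    proof (rule Infinite_Sum.abs_summable_on_comparison_test')
      show "(\<lambda>m. norm (fermi q (int m + (- k))) * (1 + 2 / (1 - (norm q)\<^sup>2))) summable_on {1..}"
        by (intro summable_on_cmult_left summable_norm_fermi_shift assms)
      show "norm ((-1) ^ m * fermi q (int m - k) * (1 - 2 * fermi q (int m)))
         \<le> norm (fermi q (int m + (- k))) * (1 + 2 / (1 - (norm q)\<^sup>2))" for m
        unfolding norm_mult norm_power using one_minus_fermi_bounded[OF assms(1), of m]
        by (simp add: mult_left_mono)
    qed
    then show ?thesis by (rule abs_summable_summable)
  qed
  have sf: "(\<lambda>m. (-1) ^ m * fermi q (int m + j)) summable_on {1..}" for j
    by (rule summable_alt_fermi_shift[OF assms(1)])
  show "h k + h (- k) = - 2 * fermi_sum q 0 - 1 / 2" if k: "k \<noteq> 0"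
  proof -
    define c where "c = 1 / (1 - 2 * fermi q k)"
    have nz: "1 - 2 * fermi q k \<noteq> 0"
    proof -
      have "1 - 2 * fermi q k = (1 - q powi (2 * k)) / (1 + q powi (2 * k))"
        using one_plus_powi_nonzero[OF assms(1), of k] by (simp add: fermi_def field_simps)
      then show ?thesis
        using one_plus_powi_nonzero[OF assms(1), of k] one_minus_powi_nonzero[OF assms(1) k] by simp
    qed
    have "h k + h (- k) = (\<Sum>\<^sub>\<infinity>m\<in>{1..}. (-1) ^ m * fermi q (int m - k) * (1 - 2 * fermi q (int m))
        + (-1) ^ m * fermi q (int m - (- k)) * (1 - 2 * fermi q (int m)))"
      unfolding h_def by (rule infsum_add[symmetric, OF s s])
    also have "\<dots> = (\<Sum>\<^sub>\<infinity>m\<in>{1..}. (- 2) * ((-1) ^ m * fermi q (int m + 0)) +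
       (c * ((-1) ^ m * fermi q (int m + (- k))) + (- c) * ((-1) ^ m * fermi q (int m + k))))"
    proof (rule infsum_cong)
      fix m :: nat
      have "(-1) ^ m * fermi q (int m - k) * (1 - 2 * fermi q (int m))
        + (-1) ^ m * fermi q (int m - (- k)) * (1 - 2 * fermi q (int m))
        = (-1) ^ m * ((fermi q (int m - k) + fermi q (int m + k)) * (1 - 2 * fermi q (int m)))"
        by (simp add: algebra_simps)
      also have "\<dots> = (- 2) * ((-1) ^ m * fermi q (int m + 0)) +
       (c * ((-1) ^ m * fermi q (int m + (- k))) + (- c) * ((-1) ^ m * fermi q (int m + k)))"
        unfolding fermi_addition[OF assms(1) k] divide_inverse c_def
        by (simp add: algebra_simps)
      finally show "(-1) ^ m * fermi q (int m - k) * (1 - 2 * fermi q (int m))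
        + (-1) ^ m * fermi q (int m - (- k)) * (1 - 2 * fermi q (int m)) = (- 2) * ((-1) ^ m * fermi q (int m + 0)) +
       (c * ((-1) ^ m * fermi q (int m + (- k))) + (- c) * ((-1) ^ m * fermi q (int m + k)))" .
    qed
    also have "\<dots> = (- 2) * fermi_sum q 0 + (c * fermi_sum q (- k) + (- c) * fermi_sum q k)"
      unfolding fermi_sum_def infsum_cmult_right'[symmetric]
      by (subst infsum_add, (intro summable_on_add summable_on_cmult_right sf)+,
          subst infsum_add) (intro summable_on_cmult_right sf refl)+
    also have "\<dots> = - 2 * fermi_sum q 0 + c * (fermi q k - 1 / 2)"
      unfolding fermi_sum_diff[OF assms(1), of k, symmetric] by (simp add: algebra_simps)
    \<comment> \<open>The factor y_k - 1/2 is -1/2 times the denominator of \<open>c\<close>, so k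
      drops out here.\<close>
    also have "c * (fermi q k - 1 / 2) = - 1 / 2"
      unfolding c_def using nz by (simp add: divide_simps)
    finally show ?thesis by simp
  qed
  have "h 0 = (\<Sum>\<^sub>\<infinity>m\<in>{1..}. 2 * ((-1) ^ m * (sech_coeff q (int m))\<^sup>2) + (-1) * ((-1) ^ m * fermi q (int m + 0)))"
    unfolding h_def
  proof (rule infsum_cong)
    fix m :: nat
    have "(-1) ^ m * fermi q (int m - 0) * (1 - 2 * fermi q (int m))
       = (-1) ^ m * (fermi q (int m) * (1 - 2 * fermi q (int m)))" by simp
    also have "\<dots> = 2 * ((-1) ^ m * (sech_coeff q (int m))\<^sup>2) + (-1) * ((-1) ^ m * fermi q (int m + 0))"
      unfolding fermi_mult_complement[OF assms(1)] by (simp add: algebra_simps)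
    finally show "(-1) ^ m * fermi q (int m - 0) * (1 - 2 * fermi q (int m)) =
      2 * ((-1) ^ m * (sech_coeff q (int m))\<^sup>2) + (-1) * ((-1) ^ m * fermi q (int m + 0))" .
  qed
  also have "\<dots> = 2 * (\<Sum>\<^sub>\<infinity>m\<in>{1..}. (-1) ^ m * (sech_coeff q (int m))\<^sup>2) + (-1) * fermi_sum q 0"
    unfolding fermi_sum_def infsum_cmult_right'[symmetric]
    by (rule infsum_add) (intro summable_on_cmult_right sf nat_infsum_sech_square(1) assms)+
  finally have h0: "h 0 = 2 * (\<Sum>\<^sub>\<infinity>m\<in>{1..}. (-1) ^ m * (sech_coeff q (int m))\<^sup>2) + (-1) * fermi_sum q 0" .
  show "2 * h 0 = 2 * (theta_sech q 0)\<^sup>2 - 1 / 2 - 2 * fermi_sum q 0"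
    unfolding h0 nat_infsum_sech_square(2)[OF assms(1)] by (simp add: algebra_simps)
qed

text \<open>Multiplication by \<open>theta q\<close> turns each Hecke sum into a convolution, and
  the order of summation is exchanged. The inner sums \<open>h k\<close>, symmetrised in k, equal
  the constant \<open>C\<close> except at k = 0; the excess there is 2 g^2, and the constant part
  accounts for the Lambert series and the leading 1.\<close>

lemma hecke_sum_identity:
  assumes "nome q"
  shows "1 + 4 * fermi_sum q 0 - 2 * (\<Sum>\<^sub>\<infinity>m\<in>{1..}. hecke_sum q m * (1 - 2 * fermi q (int m)))
       = theta (- q) * (theta (- (q\<^sup>2)))\<^sup>2"
proof -
  define F where "F = (\<lambda>m k. (-1) ^ m * (q powi (k\<^sup>2) * fermi q (int m - k)) * (1 - 2 * fermi q (int m)))"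
  define h where "h = (\<lambda>k. \<Sum>\<^sub>\<infinity>m\<in>{1..}. (-1) ^ m * fermi q (int m - k) * (1 - 2 * fermi q (int m)))"
  define L where "L = fermi_sum q 0"
  define S where "S = (\<Sum>\<^sub>\<infinity>m\<in>{1..}. hecke_sum q m * (1 - 2 * fermi q (int m)))"
  define E where "E = (theta_sech q 0)\<^sup>2"
  have sF: "(\<lambda>(m, k). F m k) summable_on {1..} \<times> UNIV"
    unfolding F_def by (rule summable_fermi_double[OF assms])
  have hk: "(\<Sum>\<^sub>\<infinity>m\<in>{1..}. F m k) = q powi (k\<^sup>2) * h k" for k
    unfolding h_def infsum_cmult_right'[symmetric] F_def by (simp add: mult_ac)
  have "(\<lambda>(k, m). F m k) summable_on UNIV \<times> {1..}"
    using sF by (subst summable_on_swap) simp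
  then have "(\<lambda>k. \<Sum>\<^sub>\<infinity>m\<in>{1..}. F m k) summable_on UNIV"
    using summable_on_Sigma_banach[of "\<lambda>k m. F m k"] by simp
  then have sG: "(\<lambda>k. q powi (k\<^sup>2) * h k) summable_on UNIV"
    by (simp only: hk)
  have sG': "(\<lambda>k. q powi (k\<^sup>2) * h (- k)) summable_on UNIV"
    using sG summable_int_reflect[of "\<lambda>k. q powi (k\<^sup>2) * h k" 0] by simp
  define C where "C = - 2 * L - 1 / 2"
  \<comment> \<open>Only h(k) + h(-k) is known; the even weight q^(k^2) allows the
    symmetrisation.\<close>
  have "2 * (\<Sum>\<^sub>\<infinity>k. q powi (k\<^sup>2) * h k) = (\<Sum>\<^sub>\<infinity>k. q powi (k\<^sup>2) * h k) + (\<Sum>\<^sub>\<infinity>k. q powi (k\<^sup>2) * h (- k))"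
    using infsum_int_reflect[of "\<lambda>k. q powi (k\<^sup>2) * h k" 0] by simp
  also have "\<dots> = (\<Sum>\<^sub>\<infinity>k. q powi (k\<^sup>2) * h k + q powi (k\<^sup>2) * h (- k))"
    by (rule infsum_add[symmetric, OF sG sG'])
  also have "\<dots> = (\<Sum>\<^sub>\<infinity>k. q powi (k\<^sup>2) * C + (if k = 0 then 2 * E else 0))"
  proof (rule infsum_cong)
    fix k :: int
    show "q powi (k\<^sup>2) * h k + q powi (k\<^sup>2) * h (- k) = q powi (k\<^sup>2) * C + (if k = 0 then 2 * E else 0)"
    proof (cases "k = 0")
      case True
      then show ?thesis
        using fermi_correlation(2)[OF assms] by (simp add: h_def C_def E_def L_def)
    next
      case False
      have "q powi (k\<^sup>2) * h k + q powi (k\<^sup>2) * h (- k) = q powi (k\<^sup>2) * (h k + h (- k))"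
        by (simp add: algebra_simps)
      then show ?thesis
        using fermi_correlation(1)[OF assms False] False by (simp add: h_def C_def L_def)
    qed
  qed
  also have "\<dots> = theta q * C + (\<Sum>\<^sub>\<infinity>k::int. if k = 0 then 2 * E else 0)"
    unfolding theta_def infsum_cmult_left'[symmetric]
  proof (rule infsum_add)
    show "(\<lambda>k. q powi (k\<^sup>2) * C) summable_on UNIV"
      by (intro summable_on_cmult_left summable_theta assms)
    show "(\<lambda>k::int. if k = 0 then 2 * E else 0) summable_on UNIV"
      by (rule finite_nonzero_values_imp_summable_on) (rule finite_subset[of _ "{0}"], auto)
  qed
  also have "(\<Sum>\<^sub>\<infinity>k::int. if k = 0 then 2 * E else 0) = (\<Sum>\<^sub>\<infinity>k\<in>{0::int}. 2 * E)"
    by (rule infsum_cong_neutral) auto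
  finally have 1: "2 * (\<Sum>\<^sub>\<infinity>k. q powi (k\<^sup>2) * h k) = theta q * C + 2 * E" by simp
  have "theta q * S = (\<Sum>\<^sub>\<infinity>m\<in>{1..}. theta q * (hecke_sum q m * (1 - 2 * fermi q (int m))))"
    unfolding S_def by (rule infsum_cmult_right'[symmetric])
  also have "\<dots> = (\<Sum>\<^sub>\<infinity>m\<in>{1..}. - 2 * (\<Sum>\<^sub>\<infinity>k. F m k))"
  proof (rule infsum_cong)
    fix m :: nat assume m: "m \<in> {1..}"
    have "(\<Sum>\<^sub>\<infinity>k. F m k) = (-1) ^ m * theta_fermi q (int m) * (1 - 2 * fermi q (int m))"
      unfolding F_def infsum_cmult_left' infsum_cmult_right' theta_fermi_def ..
    also have "- 2 * \<dots> = (-1) ^ m * (- 2 * theta_fermi q (int m)) * (1 - 2 * fermi q (int m))"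
      by simp
    also have "\<dots> = ((-1) ^ m * (-1) ^ m) * theta q * hecke_sum q m * (1 - 2 * fermi q (int m))"
      using m by (subst theta_mult_hecke_sum[OF assms, symmetric]) (auto simp: mult_ac)
    finally show "theta q * (hecke_sum q m * (1 - 2 * fermi q (int m))) = - 2 * (\<Sum>\<^sub>\<infinity>k. F m k)"
      by (simp add: mult.assoc)
  qed
  also have "\<dots> = - 2 * (\<Sum>\<^sub>\<infinity>m\<in>{1..}. \<Sum>\<^sub>\<infinity>k. F m k)"
    by (rule infsum_cmult_right')
  also have "(\<Sum>\<^sub>\<infinity>m\<in>{1..}. \<Sum>\<^sub>\<infinity>k. F m k) = (\<Sum>\<^sub>\<infinity>k. q powi (k\<^sup>2) * h k)"
    unfolding hk[symmetric] by (rule infsum_swap_banach[OF sF])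
  finally have 2: "theta q * S = - (theta q * C + 2 * E)"
    unfolding 1[symmetric] by simp
  have "4 * E = (2 * theta_sech q 0) * (2 * theta_sech q 0)"
    by (simp add: E_def power2_eq_square)
  also have "\<dots> = theta q * (theta (- q) * (theta (- (q\<^sup>2)))\<^sup>2)"
    unfolding theta_sech_0[OF assms] theta_mult_uminus[OF assms, symmetric] by (simp add: power2_eq_square)
  finally have 3: "4 * E = theta q * (theta (- q) * (theta (- (q\<^sup>2)))\<^sup>2)" .
  have "2 * (theta q * S) = theta q * (4 * L + 1) - 4 * E"
    unfolding 2 C_def by (simp add: algebra_simps)
  then have "theta q * (1 + 4 * L - 2 * S) = 4 * E"
    by algebra
  then show ?thesis
    using theta_nonzero[OF assms] unfolding 3 L_def S_def by simp
qed

section \<open>Reindexing the double and triple sums\<close>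

definition hecke_term :: "complex \<Rightarrow> nat \<times> int \<Rightarrow> complex" where
  "hecke_term q = (\<lambda>(n, k). (-1) powi k * q powi ((int n)\<^sup>2 - k\<^sup>2))"

definition hecke_cone :: "(nat \<times> int) set" where
  "hecke_cone = (SIGMA n:{1..}. {- int n<..<int n})"

text \<open>On the cone, a = n + k and b = n - k are positive of equal parity with a b = n^2 - k^2.
  Even values are 2s, 2t; odd values, in \<open>odd_part\<close>, are 2s - 1, 2t - 1.\<close>

definition even_part :: "(nat \<times> int) set" where
  "even_part = {(n, k) \<in> hecke_cone. even (int n + k)}"

definition odd_part :: "(nat \<times> int) set" where
  "odd_part = {(n, k) \<in> hecke_cone. odd (int n + k)}"

lemma even_part_bij:
  "bij_betw (\<lambda>(s, t). (s + t, int s - int t)) ({1..} \<times> {1..}) even_part"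
proof (rule bij_betw_byWitness[where f' = "\<lambda>(n, k). (nat ((int n + k) div 2), nat ((int n - k) div 2))"])
  have "nat ((int n - k) div 2) + nat ((int n + k) div 2) = n \<and> nat ((int n + k) div 2) \<ge> 1
    \<and> nat ((int n - k) div 2) \<ge> 1 \<and> int (nat ((int n + k) div 2)) - int (nat ((int n - k) div 2)) = k"
    if nk: "even (int n + k)" "- int n < k" "k < int n" for n k
  proof -
    obtain i where i: "int n + k = 2 * i" using nk(1) by (elim evenE)
    then have "int n - k = 2 * (int n - i)" by simp
    moreover have "0 < i" "i < int n" using i nk by auto
    ultimately show ?thesis unfolding i \<open>int n - k = _\<close> using i by auto
  qed
  then show "\<forall>p\<in>even_part. (\<lambda>(s, t). (s + t, int s - int t))
      ((\<lambda>(n, k). (nat ((int n + k) div 2), nat ((int n - k) div 2))) p) = p"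
    and "(\<lambda>(n, k). (nat ((int n + k) div 2), nat ((int n - k) div 2))) ` even_part \<subseteq> {1..} \<times> {1..}"
    by (auto simp: even_part_def hecke_cone_def add.commute)
qed (auto simp: even_part_def hecke_cone_def)

lemma odd_part_bij:
  "bij_betw (\<lambda>(s, t). (s + t - 1, int s - int t)) ({1..} \<times> {1..}) odd_part"
\<comment> \<open>Here n + k = 2s - 1, so 1 is added before halving.\<close>
proof (rule bij_betw_byWitness[where f' = "\<lambda>(n, k). (nat ((int n + 1 + k) div 2), nat ((int n + 1 - k) div 2))"])
  have "nat ((int n + 1 + k) div 2) + nat ((int n + 1 - k) div 2) - 1 = n \<and> nat ((int n + 1 + k) div 2) \<ge> 1
    \<and> nat ((int n + 1 - k) div 2) \<ge> 1 \<and> int (nat ((int n + 1 + k) div 2)) - int (nat ((int n + 1 - k) div 2)) = k"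
    if nk: "odd (int n + k)" "- int n < k" "k < int n" for n k
  proof -
    obtain i where i: "int n + 1 + k = 2 * i" using nk(1) by (metis add.assoc add.commute evenE odd_one odd_add)
    then have "int n + 1 - k = 2 * (int n + 1 - i)" by simp
    moreover have "0 < i" "i \<le> int n" using i nk by auto
    ultimately show ?thesis unfolding i \<open>int n + 1 - k = _\<close> using i by auto
  qed
  then show "\<forall>p\<in>odd_part. (\<lambda>(s, t). (s + t - 1, int s - int t))
      ((\<lambda>(n, k). (nat ((int n + 1 + k) div 2), nat ((int n + 1 - k) div 2))) p) = p"
    and "(\<lambda>(n, k). (nat ((int n + 1 + k) div 2), nat ((int n + 1 - k) div 2))) ` odd_part \<subseteq> {1..} \<times> {1..}"
    by (auto simp: odd_part_def hecke_cone_def)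
qed (auto simp: odd_part_def hecke_cone_def of_nat_diff)

lemma hecke_cone_split: "hecke_cone = even_part \<union> odd_part" "even_part \<inter> odd_part = {}"
  by (auto simp: even_part_def odd_part_def)

lemma minus_one_powi_int_diff: "(-1 :: complex) powi (int s - int t) = (-1) ^ (s + t)"
  by (simp add: minus_one_powi_diff power_add)

lemma hecke_term_even:
  "hecke_term q (s + t, int s - int t) = q ^ (4 * s * t) * (-1) ^ (s + t)"
proof -
  have "(int (s + t))\<^sup>2 - (int s - int t)\<^sup>2 = int (4 * s * t)"
    by (simp add: power2_eq_square algebra_simps)
  then show ?thesis
    unfolding hecke_term_def by (simp only: prod.case minus_one_powi_int_diff power_int_of_nat mult.commute)
qed

lemma hecke_term_odd:
  assumes "s \<ge> 1" "t \<ge> 1"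
  shows "hecke_term q (s + t - 1, int s - int t) = q ^ ((2 * s - 1) * (2 * t - 1)) * (-1) ^ (s + t)"
proof -
  have "(int (s + t - 1))\<^sup>2 - (int s - int t)\<^sup>2 = int ((2 * s - 1) * (2 * t - 1))"
  proof -
    obtain a b where "s = Suc a" "t = Suc b" using assms by (cases s; cases t) auto
    then show ?thesis by (simp add: power2_eq_square algebra_simps)
  qed
  then show ?thesis
    unfolding hecke_term_def by (simp only: prod.case minus_one_powi_int_diff power_int_of_nat mult.commute)
qed

text \<open>The slack 1 accommodates (2s - 1)(2t - 1), which is 1 at s = t = 1. It costs a factor
  1/r, so r = 0 is separated.\<close>

lemma summable_power_pairs:
  fixes r :: real and e :: "nat \<Rightarrow> nat \<Rightarrow> nat"
  assumes "0 \<le> r" "r < 1" "\<And>s t. s \<ge> 1 \<Longrightarrow> t \<ge> 1 \<Longrightarrow> s + t \<le> e s t + 1"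
  shows "(\<lambda>(s, t). r ^ e s t) summable_on {1..} \<times> {1..}"
proof (cases "r = 0")
  case False
  have g: "(\<lambda>n. r ^ n) summable_on {1::nat..}"
    using has_sum_geometric_from_1[of r] assms by (auto intro: has_sum_imp_summable)
  show ?thesis
  proof (rule summable_on_prod_bound)
    show "(\<lambda>n. r ^ n * inverse r) summable_on {1::nat..}" by (intro summable_on_cmult_left g)
    show "norm (case (s, t) of (s, t) \<Rightarrow> r ^ e s t) \<le> r ^ s * inverse r * r ^ t"
      if "s \<in> {1..}" "t \<in> {1..}" for s t
    proof -
      have "r ^ (e s t + 1) \<le> r ^ (s + t)"
        using assms that by (intro power_decreasing) auto
      then have "r ^ (e s t + 1) * inverse r \<le> r ^ (s + t) * inverse r"
        using assms by (intro mult_right_mono) auto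
      also have "r ^ (e s t + 1) * inverse r = r ^ e s t" using False by simp
      finally show ?thesis using assms(1) by (simp add: power_add mult_ac)
    qed
  qed (use g assms in auto)
next
  case True
  have "r ^ e s t = 0" if "s \<ge> 1" "t \<ge> 1" "(s, t) \<noteq> (1, 1)" for s t
  proof -
    have "s + t > 2" using that by auto
    then have "e s t > 0" using assms(3)[of s t] that by auto
    then show ?thesis using True by simp
  qed
  then have "{p \<in> {1..} \<times> {1..}. (case p of (s, t) \<Rightarrow> r ^ e s t) \<noteq> 0} \<subseteq> {(1, 1)}"
    by force
  then show ?thesis
    by (intro finite_nonzero_values_imp_summable_on) (rule finite_subset, auto)
qed

lemma summable_norm_hecke_term:
  assumes "nome q"
  shows "(\<lambda>p. norm (hecke_term q p)) summable_on hecke_cone"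
proof -
  have q: "0 \<le> norm q" "norm q < 1" using assms by (auto simp: nome_def)
  have le1: "s + t \<le> 4 * s * t + 1" if st: "s \<ge> 1" "t \<ge> 1" for s t :: nat
  proof -
    obtain a b where "s = Suc a" "t = Suc b" using st by (cases s; cases t) auto
    then show ?thesis by (simp add: algebra_simps)
  qed
  have le2: "s + t \<le> (2 * s - 1) * (2 * t - 1) + 1" if st: "s \<ge> 1" "t \<ge> 1" for s t :: nat
  proof -
    obtain a b where "s = Suc a" "t = Suc b" using st by (cases s; cases t) auto
    then show ?thesis by (simp add: algebra_simps)
  qed
  have "(\<lambda>p. norm (hecke_term q p)) summable_on even_part"
    using summable_power_pairs[OF q le1]
    by (subst summable_on_reindex_bij_betw[OF even_part_bij, symmetric])
       (simp add: case_prod_unfold hecke_term_even norm_mult norm_power)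
  moreover have "(\<lambda>p. norm (hecke_term q p)) summable_on odd_part"
    by (subst summable_on_reindex_bij_betw[OF odd_part_bij, symmetric],
        rule summable_on_cong[THEN iffD2, OF _ summable_power_pairs[OF q le2]])
       (auto simp: hecke_term_odd[unfolded One_nat_def] norm_mult norm_power)
  ultimately show ?thesis
    unfolding hecke_cone_split(1) by (rule summable_on_union)
qed

lemma infsum_alternating_geometric:
  fixes z :: complex
  assumes "norm z < 1"
  shows "(\<Sum>\<^sub>\<infinity>r\<in>{1..}. (-1) ^ r * z ^ r) = - (z / (1 + z))"
proof -
  have "(\<Sum>\<^sub>\<infinity>r\<in>{1..}. (- z) ^ r) = - z / (1 - (- z))"
    using assms by (intro infsumI has_sum_geometric_from_1) simp
  moreover have "(- z) ^ r = (-1) ^ r * z ^ r" for r by (rule power_minus)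
  ultimately show ?thesis by simp
qed

lemma infsum_fermi_nat:
  assumes "nome q" "n \<ge> 1"
  shows "(\<Sum>\<^sub>\<infinity>r\<in>{1..}. (-1) ^ r * q ^ (2 * r * n)) = - fermi q (int n)"
proof -
  have e: "q powi (2 * int n) = q ^ (2 * n)"
    by (metis of_nat_mult of_nat_numeral power_int_of_nat)
  have "norm (q ^ (2 * n)) < 1"
    using assms by (simp add: nome_def norm_power power_less_one_iff)
  from infsum_alternating_geometric[OF this]
  have "(\<Sum>\<^sub>\<infinity>r\<in>{1..}. (-1) ^ r * (q ^ (2 * n)) ^ r) = - fermi q (int n)"
    unfolding fermi_def e .
  moreover have "(q ^ (2 * n)) ^ r = q ^ (2 * r * n)" for r
    by (simp add: mult_ac flip: power_mult)
  ultimately show ?thesis by simp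
qed

lemma lambert_sum:
  assumes "nome q"
  shows "(\<Sum>\<^sub>\<infinity>(r, s)\<in>{1..} \<times> {1..}. q ^ (2 * r * s) * (-1) ^ (r + s)) = - fermi_sum q 0"
proof -
  have q: "0 \<le> norm q" "norm q < 1" using assms by (auto simp: nome_def)
  have le: "r + s \<le> 2 * r * s + 1" if rs: "r \<ge> 1" "s \<ge> 1" for r s :: nat
  proof -
    obtain a b where "r = Suc a" "s = Suc b" using rs by (cases r; cases s) auto
    then show ?thesis by (simp add: algebra_simps)
  qed
  have "(\<lambda>p. norm (case p of (r, s) \<Rightarrow> q ^ (2 * r * s) * (-1) ^ (r + s))) summable_on {1..} \<times> {1..}"
    using summable_power_pairs[OF q le] by (simp add: case_prod_unfold norm_mult norm_power)
  then have "(\<lambda>(r, s). q ^ (2 * r * s) * (-1) ^ (r + s)) summable_on {1..} \<times> {1..}"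
    by (rule abs_summable_summable)
  then have "(\<Sum>\<^sub>\<infinity>(r, s)\<in>{1..} \<times> {1..}. q ^ (2 * r * s) * (-1) ^ (r + s))
      = (\<Sum>\<^sub>\<infinity>r\<in>{1..}. \<Sum>\<^sub>\<infinity>s\<in>{1..}. q ^ (2 * r * s) * (-1) ^ (r + s))"
    by (rule infsum_Sigma'_banach[symmetric])
  also have "\<dots> = (\<Sum>\<^sub>\<infinity>r\<in>{1..}. (-1) ^ r * (- fermi q (int r)))"
  proof (rule infsum_cong)
    fix r :: nat assume "r \<in> {1..}"
    then have "(\<Sum>\<^sub>\<infinity>s\<in>{1..}. (-1) ^ r * ((-1) ^ s * q ^ (2 * s * r))) = (-1) ^ r * (- fermi q (int r))"
      unfolding infsum_cmult_right' by (subst infsum_fermi_nat[OF assms]) auto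
    then show "(\<Sum>\<^sub>\<infinity>s\<in>{1..}. q ^ (2 * r * s) * (-1) ^ (r + s)) = (-1) ^ r * (- fermi q (int r))"
      by (simp add: power_add mult_ac)
  qed
  finally show ?thesis by (simp add: fermi_sum_def infsum_uminus)
qed

lemma hecke_double_sums:
  assumes "nome q"
  shows "(\<Sum>\<^sub>\<infinity>(s, t)\<in>{1..} \<times> {1..}. q ^ (4 * s * t) * (-1) ^ (s + t))
       + (\<Sum>\<^sub>\<infinity>(s, t)\<in>{1..} \<times> {1..}. q ^ ((2 * s - 1) * (2 * t - 1)) * (-1) ^ (s + t))
       = infsum (hecke_term q) hecke_cone"
proof -
  have s: "hecke_term q summable_on hecke_cone"
    by (rule abs_summable_summable[OF summable_norm_hecke_term[OF assms]])
  have "(\<Sum>\<^sub>\<infinity>(s, t)\<in>{1..} \<times> {1..}. q ^ (4 * s * t) * (-1) ^ (s + t)) = infsum (hecke_term q) even_part"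
    by (subst infsum_reindex_bij_betw[OF even_part_bij, symmetric])
       (simp add: case_prod_unfold hecke_term_even)
  moreover have "(\<Sum>\<^sub>\<infinity>(s, t)\<in>{1..} \<times> {1..}. q ^ ((2 * s - 1) * (2 * t - 1)) * (-1) ^ (s + t))
      = infsum (hecke_term q) odd_part"
    by (subst infsum_reindex_bij_betw[OF odd_part_bij, symmetric], rule infsum_cong)
       (auto simp: hecke_term_odd[unfolded One_nat_def])
  moreover have "hecke_term q summable_on even_part" "hecke_term q summable_on odd_part"
    using s hecke_cone_split(1) by (auto intro: summable_on_subset_banach)
  ultimately show ?thesis
    unfolding hecke_cone_split(1) by (simp add: infsum_Un_disjoint hecke_cone_split(2))
qed

text \<open>On the cone n \<ge> 1, so |q|^(2rn) \<le> |q|^r uniformly in the cone point.\<close>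

lemma summable_hecke_triple:
  assumes "nome q"
  shows "(\<lambda>(p, r). hecke_term q p * ((-1) ^ r * q ^ (2 * r * fst p))) summable_on hecke_cone \<times> {1..}"
proof (rule summable_on_prod_bound)
  have q: "norm q < 1" using assms by (simp add: nome_def)
  show "(\<lambda>p. norm (hecke_term q p)) summable_on hecke_cone"
    by (rule summable_norm_hecke_term[OF assms])
  show "(\<lambda>r. norm q ^ r) summable_on {1..}"
    using has_sum_geometric_from_1[of "norm q"] q by (auto intro: has_sum_imp_summable)
  show "norm (case (p, r) of (p, r) \<Rightarrow> hecke_term q p * ((-1) ^ r * q ^ (2 * r * fst p)))
      \<le> norm (hecke_term q p) * norm q ^ r" if "p \<in> hecke_cone" for p r
  proof -
    have "r * 1 \<le> r * fst p" using that by (intro mult_le_mono) (auto simp: hecke_cone_def)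
    then have "norm q ^ (2 * r * fst p) \<le> norm q ^ r"
      using q by (intro power_decreasing) auto
    then show ?thesis by (simp add: norm_mult norm_power mult_left_mono)
  qed
qed auto

text \<open>Both r-dependent parts of the exponents equal 2rn: 2rs + 2rt with n = s + t, and r(2s -
  1) + r(2t - 1) with n = s + t - 1. Hence both triple sums share one geometric series over
  r.\<close>

lemma hecke_triple_sums:
  assumes "nome q"
  shows "(\<Sum>\<^sub>\<infinity>(r, s, t)\<in>{1..} \<times> {1..} \<times> {1..}. q ^ (2 * r * s + 2 * r * t + 4 * s * t) * (-1) ^ (r + s + t))
       + (\<Sum>\<^sub>\<infinity>(r, s, t)\<in>{1..} \<times> {1..} \<times> {1..}.
            q ^ (r * (2 * s - 1) + r * (2 * t - 1) + (2 * s - 1) * (2 * t - 1)) * (-1) ^ (r + s + t))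
       = - (\<Sum>\<^sub>\<infinity>p\<in>hecke_cone. hecke_term q p * fermi q (int (fst p)))"
    and "(\<lambda>p. hecke_term q p * fermi q (int (fst p))) summable_on hecke_cone"
proof -
  let ?F = "\<lambda>(p, r). hecke_term q p * ((-1) ^ r * q ^ (2 * r * fst p))"
  note s = summable_hecke_triple[OF assms]
  have sub: "?F summable_on A \<times> {1..}" if "A \<subseteq> hecke_cone" for A
    using s by (rule summable_on_subset_banach) (use that in auto)
  have inner: "(\<Sum>\<^sub>\<infinity>r\<in>{1..}. hecke_term q p * ((-1) ^ r * q ^ (2 * r * fst p)))
      = - (hecke_term q p * fermi q (int (fst p)))" if "p \<in> hecke_cone" for p
    unfolding infsum_cmult_right'
    by (subst infsum_fermi_nat[OF assms]) (use that in \<open>auto simp: hecke_cone_def\<close>)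
  have bij1: "bij_betw (\<lambda>(r, s, t). ((s + t, int s - int t), r)) ({1::nat..} \<times> {1..} \<times> {1..}) (even_part \<times> {1..})"
  proof -
    have "bij_betw (\<lambda>(r, p). (p, r)) ({1::nat..} \<times> ({1::nat..} \<times> {1::nat..})) (({1..} \<times> {1..}) \<times> {1..})"
      by (rule bij_betw_byWitness[where f' = "\<lambda>(p, r). (r, p)"]) auto
    from bij_betw_trans[OF this bij_betw_map_prod[OF even_part_bij bij_betw_id]]
    show ?thesis by (simp add: o_def case_prod_unfold)
  qed
  have bij2: "bij_betw (\<lambda>(r, s, t). ((s + t - 1, int s - int t), r)) ({1::nat..} \<times> {1..} \<times> {1..}) (odd_part \<times> {1..})"
  proof -
    have "bij_betw (\<lambda>(r, p). (p, r)) ({1::nat..} \<times> ({1::nat..} \<times> {1::nat..})) (({1..} \<times> {1..}) \<times> {1..})"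
      by (rule bij_betw_byWitness[where f' = "\<lambda>(p, r). (r, p)"]) auto
    from bij_betw_trans[OF this bij_betw_map_prod[OF odd_part_bij bij_betw_id]]
    show ?thesis by (simp add: o_def case_prod_unfold)
  qed
  have "(\<Sum>\<^sub>\<infinity>(r, s, t)\<in>{1..} \<times> {1..} \<times> {1..}. q ^ (2 * r * s + 2 * r * t + 4 * s * t) * (-1) ^ (r + s + t))
      = infsum ?F (even_part \<times> {1..})"
    by (subst infsum_reindex_bij_betw[OF bij1, symmetric], rule infsum_cong)
       (auto simp: hecke_term_even power_add algebra_simps)
  moreover have "(\<Sum>\<^sub>\<infinity>(r, s, t)\<in>{1..} \<times> {1..} \<times> {1..}.
            q ^ (r * (2 * s - 1) + r * (2 * t - 1) + (2 * s - 1) * (2 * t - 1)) * (-1) ^ (r + s + t))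
      = infsum ?F (odd_part \<times> {1..})"
  proof (subst infsum_reindex_bij_betw[OF bij2, symmetric], rule infsum_cong)
    fix x :: "nat \<times> nat \<times> nat" assume "x \<in> {1..} \<times> {1..} \<times> {1..}"
    then obtain r s t where x: "x = (r, s, t)" and st: "1 \<le> s" "1 \<le> t" by auto
    obtain a b where "s = Suc a" "t = Suc b" using st by (cases s; cases t) auto
    then have e: "r * (2 * s - 1) + r * (2 * t - 1) = 2 * r * (s + t - 1)"
      by (simp add: algebra_simps)
    show "(case x of (r, s, t) \<Rightarrow>
        q ^ (r * (2 * s - 1) + r * (2 * t - 1) + (2 * s - 1) * (2 * t - 1)) * (-1) ^ (r + s + t))
       = ?F (case x of (r, s, t) \<Rightarrow> ((s + t - 1, int s - int t), r))"
      unfolding x prod.case fst_conv hecke_term_odd[OF st] e unfolding power_add by (simp only: mult_ac)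
  qed
  moreover have "infsum ?F (even_part \<times> {1..}) + infsum ?F (odd_part \<times> {1..}) = infsum ?F (hecke_cone \<times> {1..})"
    unfolding hecke_cone_split(1) Sigma_Un_distrib1
    by (rule infsum_Un_disjoint[symmetric, OF sub sub]) (use hecke_cone_split in auto)
  moreover have "infsum ?F (hecke_cone \<times> {1..}) = (\<Sum>\<^sub>\<infinity>p\<in>hecke_cone. - (hecke_term q p * fermi q (int (fst p))))"
    unfolding infsum_Sigma'_banach[OF s, symmetric] by (rule infsum_cong) (rule inner)
  ultimately show "(\<Sum>\<^sub>\<infinity>(r, s, t)\<in>{1..} \<times> {1..} \<times> {1..}. q ^ (2 * r * s + 2 * r * t + 4 * s * t) * (-1) ^ (r + s + t))
       + (\<Sum>\<^sub>\<infinity>(r, s, t)\<in>{1..} \<times> {1..} \<times> {1..}.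
            q ^ (r * (2 * s - 1) + r * (2 * t - 1) + (2 * s - 1) * (2 * t - 1)) * (-1) ^ (r + s + t))
       = - (\<Sum>\<^sub>\<infinity>p\<in>hecke_cone. hecke_term q p * fermi q (int (fst p)))"
    by (simp add: infsum_uminus)
  have "(\<lambda>p. - (hecke_term q p * fermi q (int (fst p)))) summable_on hecke_cone"
    using summable_on_Sigma_banach[OF s] inner by (simp cong: summable_on_cong)
  then show "(\<lambda>p. hecke_term q p * fermi q (int (fst p))) summable_on hecke_cone"
    by (simp add: summable_on_uminus)
qed

lemma hecke_cone_sum:
  assumes "nome q"
  shows "infsum (hecke_term q) hecke_cone - 2 * (\<Sum>\<^sub>\<infinity>p\<in>hecke_cone. hecke_term q p * fermi q (int (fst p)))
       = (\<Sum>\<^sub>\<infinity>m\<in>{1..}. hecke_sum q m * (1 - 2 * fermi q (int m)))"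
proof -
  let ?g = "\<lambda>n k. hecke_term q (n, k) * (1 - 2 * fermi q (int n))"
  have s1: "hecke_term q summable_on hecke_cone"
    by (rule abs_summable_summable[OF summable_norm_hecke_term[OF assms]])
  have s2: "(\<lambda>p. (-2) * (hecke_term q p * fermi q (int (fst p)))) summable_on hecke_cone"
    by (intro summable_on_cmult_right hecke_triple_sums(2) assms)
  have g: "hecke_term q p + (-2) * (hecke_term q p * fermi q (int (fst p))) = (case p of (n, k) \<Rightarrow> ?g n k)" for p
    by (cases p) (simp add: algebra_simps)
  have sg: "(\<lambda>(n, k). ?g n k) summable_on hecke_cone"
    using summable_on_add[OF s1 s2] unfolding g .
  have "infsum (hecke_term q) hecke_cone - 2 * (\<Sum>\<^sub>\<infinity>p\<in>hecke_cone. hecke_term q p * fermi q (int (fst p)))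
     = infsum (hecke_term q) hecke_cone + (\<Sum>\<^sub>\<infinity>p\<in>hecke_cone. (-2) * (hecke_term q p * fermi q (int (fst p))))"
    unfolding infsum_cmult_right' by simp
  also have "\<dots> = (\<Sum>\<^sub>\<infinity>(n, k)\<in>hecke_cone. ?g n k)"
    unfolding infsum_add[OF s1 s2, symmetric] g ..
  also have "\<dots> = (\<Sum>\<^sub>\<infinity>n\<in>{1..}. \<Sum>\<^sub>\<infinity>k\<in>{- int n<..<int n}. ?g n k)"
    using sg unfolding hecke_cone_def by (rule infsum_Sigma'_banach[symmetric])
  also have "\<dots> = (\<Sum>\<^sub>\<infinity>m\<in>{1..}. hecke_sum q m * (1 - 2 * fermi q (int m)))"
    by (simp add: hecke_sum_def hecke_term_def sum_distrib_right)
  finally show ?thesis .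
qed

theorem theorem1p5:
  fixes q :: complex
  assumes "norm q < 1"
  shows
    "1 - 4 * (\<Sum>\<^sub>\<infinity>(r::nat, s::nat)\<in>{1..} \<times> {1..}. q ^ (2 * r * s) * (-1) ^ (r+s))
       - 2 * (\<Sum>\<^sub>\<infinity>(s::nat, t::nat)\<in>{1..} \<times> {1..}. q ^ (4 * s * t) * (-1) ^ (s+t))
       - 2 * (\<Sum>\<^sub>\<infinity>(s::nat, t::nat)\<in>{1..} \<times> {1..}. q ^ ((2 * s-1) * (2 * t-1)) * (-1) ^ (s+t))
       - 4 * (\<Sum>\<^sub>\<infinity>(r::nat, s::nat, t::nat)\<in>{1..} \<times> {1..} \<times> {1..}.
                q ^ (2 * r * s + 2 * r * t + 4 * s * t) * (-1) ^ (r+s+t))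
       - 4 * (\<Sum>\<^sub>\<infinity>(r::nat, s::nat, t::nat)\<in>{1..} \<times> {1..} \<times> {1..}.
                q ^ (r * (2 * s-1) + r * (2 * t-1) + (2 * s-1) * (2 * t-1)) * (-1) ^ (r+s+t))
     = qpochhammer_inf q q / qpochhammer_inf (-q) q
         * (qpochhammer_inf (q^2) (q^2) / qpochhammer_inf (-(q^2)) (q^2)) ^ 2"
    (is "1 - 4 * ?A - 2 * ?B - 2 * ?C - 4 * ?D - 4 * ?E = ?R")
proof (cases "q = 0")
  case True
  \<comment> \<open>Every exponent is positive on the index sets, so all terms vanish; every product
    on the right is 1.\<close>
  have "?A = 0" "?B = 0" "?C = 0" "?D = 0" "?E = 0"
    by (rule infsum_0, auto simp: True power_0_left)+
  then show ?thesis by (simp add: True qpochhammer_inf_def)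
next
  case False
  then have q: "nome q" using assms by (simp add: nome_def)
  then have q2: "nome (q\<^sup>2)" by (simp add: nome_power)
  have "1 - 4 * ?A - 2 * ?B - 2 * ?C - 4 * ?D - 4 * ?E = 1 - 4 * ?A - 2 * (?B + ?C) - 4 * (?D + ?E)"
    by (simp add: algebra_simps)
  also have "\<dots> = 1 + 4 * fermi_sum q 0 - 2 * (\<Sum>\<^sub>\<infinity>m\<in>{1..}. hecke_sum q m * (1 - 2 * fermi q (int m)))"
    unfolding lambert_sum[OF q] hecke_double_sums[OF q] hecke_triple_sums(1)[OF q] hecke_cone_sum[OF q, symmetric]
    by (simp add: algebra_simps)
  also have "\<dots> = theta (- q) * (theta (- (q\<^sup>2)))\<^sup>2"
    by (rule hecke_sum_identity[OF q])
  finally show ?thesis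
    unfolding theta_gauss[OF q] theta_gauss[OF q2] .
qed

end
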